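(* Let $n\ge 1$ be an integer, let $0<a_1<a_2<\dots<a_n$ be real numbers, and let $\varphi_s,\psi_s$ ($s=0,\dots,n-1$) be given sufficiently smooth functions on $[0,1]$ satisfying the natural compatibility conditions. For each $k\in\mathbb N=\{1,2,\dots\}$ let $\Delta=\Delta(k)$ be the determinant of the $4n\times 4n$ linear system defined in the context. If the Dirichlet problem with data $\varphi_s,\psi_s$ (defined in the context) has a solution, then this solution is unique if and only if $\Delta(k)\neq 0$ for all $k\in\mathbb N$.
   Context: Setting. $\Omega=\{(x,y):0<x<1,\,-1<y<1\}$, $\Omega_+=\Omega\cap\{y>0\}$, $\Omega_-=\Omega\cap\{y<0\}$, and $$Lu=\left\{\prod_{j=1}^n\left(a_j^2\frac{\partial^2}{\partial x^2}+\operatorname{sgn}(y)\frac{\partial^2}{\partial y^2}\right)\right\}u .$$ Dirichlet problem: find a function $u$ such that (i) $u\in C^{2n-1}(\overline\Omega)\cap C^{2n}(\Omega_+\cup\Omega_-)$; (ii) $Lu(x,y)=0$ for $(x,y)\in\Omega_+\cup\Omega_-$; (iii) $D_x^{2s}u(0,y)=D_x^{2s}u(1,y)=0$ for $-1\le y\le 1$; (iv) $D_y^{2s}u(x,1)=\varphi_s(x)$ for $0\le x\le 1$; (v) $D_y^{2s}u(x,-1)=\psi_s(x)$ for $0\le x\le 1$; where in (iii)-(v) $s=0,1,\dots,n-1$. The determinant $\Delta(k)$. Fix $k\in\mathbb N$. $\Delta(k)$ is the determinant of the coefficient matrix of the following linear system of $4n$ equations in the $4n$ unknowns $c_1,\dots,c_{2n},d_1,\dots,d_{2n}$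 (the order of rows and columns only affects its sign): $$\sum_{s=1}^n\left(c_{2s-1}a_s^{2m}e^{\pi k a_s}+c_{2s}a_s^{2m}e^{-\pi k a_s}\right)=\frac{\varphi_{mk}}{(\pi k)^{2m}},\quad m=0,\dots,n-1,$$ $$\sum_{s=1}^n\left(d_{2s-1}a_s^{2m}\cos(\pi k a_s)-d_{2s}a_s^{2m}\sin(\pi k a_s)\right)=(-1)^m\frac{\psi_{mk}}{(\pi k)^{2m}},\quad m=0,\dots,n-1,$$ $$\sum_{s=1}^n\left(c_{2s-1}a_s^t+c_{2s}(-a_s)^t\right)-\sum_{s=1}^n\left(d_{2s-1}a_s^t\cos\frac{\pi t}{2}+d_{2s}a_s^t\sin\frac{\pi t}{2}\right)=0,\quad t=0,\dots,2n-1,$$ where $\varphi_{mk}=\sqrt2\int_0^1\varphi_m(x)\sin(\pi kx)\,dx$ and $\psi_{mk}=\sqrt2\int_0^1\psi_m(x)\sin(\pi kx)\,dx$. *)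

theory Defs
  imports "HOL-Analysis.Analysis" "Jordan_Normal_Form.Determinant"
begin

definition Omega :: "(real \<times> real) set" where
  "Omega = {(x, y). 0 < x \<and> x < 1 \<and> -1 < y \<and> y < 1}"

definition Omega_plus :: "(real \<times> real) set" where
  "Omega_plus = Omega \<inter> {(x, y). 0 < y}"

definition Omega_minus :: "(real \<times> real) set" where
  "Omega_minus = Omega \<inter> {(x, y). y < 0}"

text \<open>Partial derivatives relative to a set: on an open set these are the ordinary ones; on the
  closed rectangle \<open>closure Omega\<close> they are one-sided at the edges, which gives a meaning to the
  derivatives occurring in the boundary conditions.\<close>

definition Dx :: "(real \<times> real) set \<Rightarrow> (real \<times> real \<Rightarrow> real) \<Rightarrow> real \<times> real \<Rightarrow> real" where
  "Dx S u = (\<lambda>(x, y). vector_derivative (\<lambda>t. u (t, y)) (at x within {t. (t, y) \<in> S}))"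

definition Dy :: "(real \<times> real) set \<Rightarrow> (real \<times> real \<Rightarrow> real) \<Rightarrow> real \<times> real \<Rightarrow> real" where
  "Dy S u = (\<lambda>(x, y). vector_derivative (\<lambda>t. u (x, t)) (at y within {t. (x, t) \<in> S}))"

definition partially_differentiable_on ::
    "(real \<times> real) set \<Rightarrow> (real \<times> real \<Rightarrow> real) \<Rightarrow> bool" where
  "partially_differentiable_on S u \<longleftrightarrow> (\<forall>(x, y) \<in> S.
     (\<lambda>t. u (t, y)) differentiable (at x within {t. (t, y) \<in> S}) \<and>
     (\<lambda>t. u (x, t)) differentiable (at y within {t. (x, t) \<in> S}))"

text \<open>All iterated partial derivatives of order at most \<open>k\<close> (in every order of differentiation)
  exist and are continuous on \<open>S\<close>. For \<open>S = closure Omega\<close> this agrees with the definition of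
  \<open>C\<^sup>k\<close> up to the boundary by continuous extension of the derivatives from the interior.\<close>

primrec C_k_on :: "nat \<Rightarrow> (real \<times> real) set \<Rightarrow> (real \<times> real \<Rightarrow> real) \<Rightarrow> bool" where
  "C_k_on 0 S u \<longleftrightarrow> continuous_on S u"
| "C_k_on (Suc k) S u \<longleftrightarrow>
     continuous_on S u \<and> partially_differentiable_on S u \<and> C_k_on k S (Dx S u) \<and> C_k_on k S (Dy S u)"

definition L_factor ::
    "(real \<times> real) set \<Rightarrow> real \<Rightarrow> (real \<times> real \<Rightarrow> real) \<Rightarrow> real \<times> real \<Rightarrow> real" where
  "L_factor S b u = (\<lambda>(x, y). b\<^sup>2 * Dx S (Dx S u) (x, y) + sgn y * Dy S (Dy S u) (x, y))"

text \<open>The product of the factors is their composition. They commute on \<open>C\<^sup>2\<^sup>n\<close> functions on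
  \<open>Omega_plus \<union> Omega_minus\<close>, where \<open>sgn y\<close> is locally constant.\<close>

definition L_op ::
    "nat \<Rightarrow> (nat \<Rightarrow> real) \<Rightarrow> (real \<times> real \<Rightarrow> real) \<Rightarrow> real \<times> real \<Rightarrow> real" where
  "L_op n a u = foldr (\<lambda>j. L_factor (Omega_plus \<union> Omega_minus) (a j)) [1..<Suc n] u"

text \<open>Only the values of \<open>u\<close> on \<open>closure Omega\<close> matter. The existence of a solution forces the
  data to be as regular and as compatible as the problem requires, so no separate
  assumption on \<open>\<phi>\<close> and \<open>\<psi>\<close> is made.\<close>

definition dirichlet_solution ::
    "nat \<Rightarrow> (nat \<Rightarrow> real) \<Rightarrow> (nat \<Rightarrow> real \<Rightarrow> real) \<Rightarrow> (nat \<Rightarrow> real \<Rightarrow> real) \<Rightarrow>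
      (real \<times> real \<Rightarrow> real) \<Rightarrow> bool" where
  "dirichlet_solution n a \<phi> \<psi> u \<longleftrightarrow>
     C_k_on (2 * n - 1) (closure Omega) u \<and>
     C_k_on (2 * n) (Omega_plus \<union> Omega_minus) u \<and>
     (\<forall>p \<in> Omega_plus \<union> Omega_minus. L_op n a u p = 0) \<and>
     (\<forall>s<n. \<forall>y\<in>{-1..1}. (Dx (closure Omega) ^^ (2 * s)) u (0, y) = 0 \<and>
                          (Dx (closure Omega) ^^ (2 * s)) u (1, y) = 0) \<and>
     (\<forall>s<n. \<forall>x\<in>{0..1}. (Dy (closure Omega) ^^ (2 * s)) u (x, 1) = \<phi> s x) \<and>
     (\<forall>s<n. \<forall>x\<in>{0..1}. (Dy (closure Omega) ^^ (2 * s)) u (x, -1) = \<psi> s x)"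

text \<open>The columns, counted from 0, belong to the unknowns \<open>c\<^sub>1, \<dots>, c\<^sub>2\<^sub>n, d\<^sub>1, \<dots>, d\<^sub>2\<^sub>n\<close>
  in this order; with \<open>a\<close> indexed from 1, the columns \<open>2 * s - 2\<close> and \<open>2 * s - 1\<close> of
  either block involve \<open>a s\<close>. The first \<open>n\<close> rows are the conditions at \<open>y = 1\<close>, the next \<open>n\<close> rows
  those at \<open>y = -1\<close>, and the last \<open>2 * n\<close> rows the matching conditions at \<open>y = 0\<close>. The lemma
  \<open>coeff_matrix_mult\<close> below recovers the linear system.\<close>

definition c_coeff :: "nat \<Rightarrow> (nat \<Rightarrow> real) \<Rightarrow> nat \<Rightarrow> nat \<Rightarrow> nat \<Rightarrow> real" where
  "c_coeff n a k i j =
    (let b = a (j div 2 + 1) in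
     if i < n then b ^ (2 * i) * (if even j then exp (pi * real k * b) else exp (- (pi * real k * b)))
     else if i < 2 * n then 0
     else (if even j then b else - b) ^ (i - 2 * n))"

definition d_coeff :: "nat \<Rightarrow> (nat \<Rightarrow> real) \<Rightarrow> nat \<Rightarrow> nat \<Rightarrow> nat \<Rightarrow> real" where
  "d_coeff n a k i j =
    (let b = a (j div 2 + 1) in
     if i < n then 0
     else if i < 2 * n then
       b ^ (2 * (i - n)) * (if even j then cos (pi * real k * b) else - sin (pi * real k * b))
     else - (b ^ (i - 2 * n) *
       (if even j then cos (pi * real (i - 2 * n) / 2) else sin (pi * real (i - 2 * n) / 2))))"

definition coeff_matrix :: "nat \<Rightarrow> (nat \<Rightarrow> real) \<Rightarrow> nat \<Rightarrow> real Matrix.mat" where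
  "coeff_matrix n a k = Matrix.mat (4 * n) (4 * n)
     (\<lambda>(i, j). if j < 2 * n then c_coeff n a k i j else d_coeff n a k i (j - 2 * n))"

definition Delta :: "nat \<Rightarrow> (nat \<Rightarrow> real) \<Rightarrow> nat \<Rightarrow> real" where
  "Delta n a k = Determinant.det (coeff_matrix n a k)"

lemma sum_pairs: "(\<Sum>j<2 * n. f j) = (\<Sum>s=1..n. f (2 * s - 2) + f (2 * s - 1))"
  for f :: "nat \<Rightarrow> real"
  by (induction n) simp_all

lemma coeff_matrix_mult:
  fixes a c d :: "nat \<Rightarrow> real" and n k :: nat
  defines "v \<equiv> Matrix.vec (4 * n) (\<lambda>j. if j < 2 * n then c (j + 1) else d (j - 2 * n + 1))"
  shows "m < n \<Longrightarrow> Matrix.vec_index (mult_mat_vec (coeff_matrix n a k) v) m =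
      (\<Sum>s=1..n. c (2 * s - 1) * a s ^ (2 * m) * exp (pi * real k * a s) +
                 c (2 * s) * a s ^ (2 * m) * exp (- pi * real k * a s))"
    and "m < n \<Longrightarrow> Matrix.vec_index (mult_mat_vec (coeff_matrix n a k) v) (n + m) =
      (\<Sum>s=1..n. d (2 * s - 1) * a s ^ (2 * m) * cos (pi * real k * a s) -
                 d (2 * s) * a s ^ (2 * m) * sin (pi * real k * a s))"
    and "t < 2 * n \<Longrightarrow> Matrix.vec_index (mult_mat_vec (coeff_matrix n a k) v) (2 * n + t) =
      (\<Sum>s=1..n. c (2 * s - 1) * a s ^ t + c (2 * s) * (- a s) ^ t) -
      (\<Sum>s=1..n. d (2 * s - 1) * a s ^ t * cos (pi * real t / 2) +
                 d (2 * s) * a s ^ t * sin (pi * real t / 2))"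
proof -
  have split: "(\<Sum>j<4 * n. g j) = (\<Sum>j<2 * n. g j) + (\<Sum>j<2 * n. g (2 * n + j))"
    for g :: "nat \<Rightarrow> real"
  proof -
    have "(\<Sum>j<m + p. g j) = (\<Sum>j<m. g j) + (\<Sum>j<p. g (m + j))" for m p
      by (induction p) simp_all
    from this[of "2 * n" "2 * n"] show ?thesis by simp
  qed
  have row: "Matrix.vec_index (mult_mat_vec (coeff_matrix n a k) v) i =
      (\<Sum>s=1..n. c_coeff n a k i (2 * s - 2) * c (2 * s - 1) + c_coeff n a k i (2 * s - 1) * c (2 * s)) +
      (\<Sum>s=1..n. d_coeff n a k i (2 * s - 2) * d (2 * s - 1) + d_coeff n a k i (2 * s - 1) * d (2 * s))"
    if "i < 4 * n" for i
  proof -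
    have "Matrix.vec_index (mult_mat_vec (coeff_matrix n a k) v) i =
        (\<Sum>j<2 * n. c_coeff n a k i j * c (j + 1)) + (\<Sum>j<2 * n. d_coeff n a k i j * d (j + 1))"
      using that
      by (simp add: coeff_matrix_def v_def scalar_prod_def atLeast0LessThan split)
    also have "(\<Sum>j<2 * n. c_coeff n a k i j * c (j + 1)) =
        (\<Sum>s=1..n. c_coeff n a k i (2 * s - 2) * c (2 * s - 1) + c_coeff n a k i (2 * s - 1) * c (2 * s))"
      unfolding sum_pairs by (intro sum.cong refl) (auto simp: Suc_le_eq dest!: gr0_implies_Suc)
    also have "(\<Sum>j<2 * n. d_coeff n a k i j * d (j + 1)) =
        (\<Sum>s=1..n. d_coeff n a k i (2 * s - 2) * d (2 * s - 1) + d_coeff n a k i (2 * s - 1) * d (2 * s))"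
      unfolding sum_pairs by (intro sum.cong refl) (auto simp: Suc_le_eq dest!: gr0_implies_Suc)
    finally show ?thesis .
  qed
  have idx: "even (2 * s - 2)" "odd (2 * s - 1)" "(2 * s - 2) div 2 + 1 = s" "(2 * s - 1) div 2 + 1 = s"
    if "s \<in> {1..n}" for s :: nat
    using that by (cases s; simp)+
  show "Matrix.vec_index (mult_mat_vec (coeff_matrix n a k) v) m =
      (\<Sum>s=1..n. c (2 * s - 1) * a s ^ (2 * m) * exp (pi * real k * a s) +
                 c (2 * s) * a s ^ (2 * m) * exp (- pi * real k * a s))" if "m < n"
  proof -
    from that have "m < 4 * n" by simp
    from row[OF this] show ?thesis
      using that by (simp only: c_coeff_def d_coeff_def Let_def idx cong: sum.cong)
        (simp add: algebra_simps sum.distrib sum_subtractf sum_negf)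
  qed
  show "Matrix.vec_index (mult_mat_vec (coeff_matrix n a k) v) (n + m) =
      (\<Sum>s=1..n. d (2 * s - 1) * a s ^ (2 * m) * cos (pi * real k * a s) -
                 d (2 * s) * a s ^ (2 * m) * sin (pi * real k * a s))" if "m < n"
  proof -
    from that have "n + m < 4 * n" by simp
    from row[OF this] show ?thesis
      using that by (simp only: c_coeff_def d_coeff_def Let_def idx cong: sum.cong)
        (simp add: algebra_simps sum.distrib sum_subtractf sum_negf)
  qed
  show "Matrix.vec_index (mult_mat_vec (coeff_matrix n a k) v) (2 * n + t) =
      (\<Sum>s=1..n. c (2 * s - 1) * a s ^ t + c (2 * s) * (- a s) ^ t) -
      (\<Sum>s=1..n. d (2 * s - 1) * a s ^ t * cos (pi * real t / 2) +
                 d (2 * s) * a s ^ t * sin (pi * real t / 2))" if "t < 2 * n"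
  proof -
    from that have "2 * n + t < 4 * n" by simp
    from row[OF this] show ?thesis
      using that by (simp only: c_coeff_def d_coeff_def Let_def idx cong: sum.cong)
        (simp add: algebra_simps sum.distrib sum_subtractf sum_negf)
  qed
qed

end

theory Submission
  imports Defs
begin

text \<open>
  The sine coefficients \<open>V y = (\<integral>\<^sub>0\<^sup>1 w (x, y) sin \<pi>kx dx)\<close> of a difference \<open>w\<close> of two solutions satisfy
  \<open>\<Prod>\<^sub>j (\<sigma> D\<^sup>2 - (\<pi>ka\<^sub>j)\<^sup>2) V = 0\<close> with \<open>\<sigma> = sgn y\<close> on either side of \<open>y = 0\<close>. As the frequencies are
  distinct, \<open>V\<close> is a combination of \<open>e\<^sup>\<plusminus>\<^sup>\<mu>\<^sup>y\<close>, respectively \<open>cos \<mu>y\<close> and \<open>sin \<mu>y\<close>, with \<open>\<mu> = \<pi>ka\<^sub>j\<close>; the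
  boundary conditions and the continuity of \<open>2n - 1\<close> derivatives at \<open>y = 0\<close> say that its coefficients
  lie in the kernel of the matrix. If every \<open>Delta n a k\<close> is nonzero, all sine coefficients of \<open>w\<close> vanish
  and so does \<open>w\<close>. Conversely, a kernel vector for some \<open>k\<close> gives a nonzero solution \<open>sin \<pi>kx V y\<close>
  with zero data, which can be added to any solution.
\<close>

subsection \<open>Partial derivatives relative to a set\<close>

text \<open>The regularity gap shapes the uniqueness half: up to the boundary a solution has one
  derivative less than its equation involves. Splitting off the factor that acts first leaves a
  function of the same kind for one factor less, but its lateral conditions have to be derived by
  exchanging \<open>Dx\<close> and \<open>Dy\<close> at points of the edges, where derivatives are
  one-sided. This is why commutation is proved on closed rectangles. Only when a single factor is
  left may second derivatives be unbounded near the boundary. The last block of the matrix has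
  \<open>2 * n\<close> rows because the derivatives of V of orders 0 to \<open>2 * n - 1\<close> are
  continuous at y = 0. In the converse the same rows give a glued function with just the required
  regularity on the closed rectangle; a jump of its derivative of order \<open>2 * n\<close> at y =
  0 is harmless, as the equation is only required off that line. The kernel is handled through
  functions instead of vectors: nonzero coefficients mean a nonzero function because modes with
  distinct frequencies are linearly independent.\<close>

lemma Dx_cong:
  assumes "\<And>p. p \<in> S \<Longrightarrow> u p = v p" "p \<in> S"
  shows "Dx S u p = Dx S v p"
  using assms by (cases p) (auto simp: Dx_def intro!: vector_derivative_cong_eq)

lemma Dy_cong:
  assumes "\<And>p. p \<in> S \<Longrightarrow> u p = v p" "p \<in> S"
  shows "Dy S u p = Dy S v p"
  using assms by (cases p) (auto simp: Dy_def intro!: vector_derivative_cong_eq)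

lemma C_k_on_cong:
  assumes "\<And>p. p \<in> S \<Longrightarrow> u p = v p" "C_k_on k S u"
  shows "C_k_on k S v"
  using assms
proof (induction k arbitrary: u v)
  case 0
  then show ?case using continuous_on_cong[of S S u v] by simp
next
  case (Suc k)
  have "partially_differentiable_on S v"
    unfolding partially_differentiable_on_def
  proof (clarify, intro conjI)
    fix x y assume xy: "(x, y) \<in> S"
    have u: "(\<lambda>t. u (t, y)) differentiable (at x within {t. (t, y) \<in> S})"
      "(\<lambda>t. u (x, t)) differentiable (at y within {t. (x, t) \<in> S})"
      using Suc.prems(2) xy by (auto simp: partially_differentiable_on_def)
    show "(\<lambda>t. v (t, y)) differentiable (at x within {t. (t, y) \<in> S})"
      using u(1) by (rule differentiable_transform_within[where d = 1]) (use xy Suc.prems(1) in auto)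
    show "(\<lambda>t. v (x, t)) differentiable (at y within {t. (x, t) \<in> S})"
      using u(2) by (rule differentiable_transform_within[where d = 1]) (use xy Suc.prems(1) in auto)
  qed
  moreover have "C_k_on k S (Dx S v)" "C_k_on k S (Dy S v)"
    using Suc.prems(2) Suc.IH[of "Dx S u" "Dx S v"] Suc.IH[of "Dy S u" "Dy S v"]
      Dx_cong[OF Suc.prems(1)] Dy_cong[OF Suc.prems(1)] by auto
  moreover have "continuous_on S v"
    using Suc.prems continuous_on_cong[of S S u v] by simp
  ultimately show ?case by simp
qed

lemma C_k_on_Suc_D: "C_k_on (Suc k) S u \<Longrightarrow> C_k_on k S u"
proof (induction k arbitrary: u)
  case (Suc k)
  from Suc.prems show ?case
    unfolding C_k_on.simps(2)[of "Suc k"] C_k_on.simps(2)[of k S u] using Suc.IH by blast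
qed simp

lemma C_k_on_mono:
  assumes "C_k_on k S u" "j \<le> k" shows "C_k_on j S u"
  using assms(2,1) by (induction rule: inc_induct) (blast dest: C_k_on_Suc_D)+

lemma C_k_on_imp_continuous_on: "C_k_on k S u \<Longrightarrow> continuous_on S u"
  by (cases k) auto

lemma C_k_on_Dx: "C_k_on (i + k) S u \<Longrightarrow> C_k_on k S ((Dx S ^^ i) u)"
proof (induction i arbitrary: k)
  case (Suc i)
  then have "C_k_on (Suc k) S ((Dx S ^^ i) u)" by (intro Suc.IH) simp
  then show ?case by simp
qed simp

lemma C_k_on_Dy: "C_k_on (i + k) S u \<Longrightarrow> C_k_on k S ((Dy S ^^ i) u)"
proof (induction i arbitrary: k)
  case (Suc i)
  then have "C_k_on (Suc k) S ((Dy S ^^ i) u)" by (intro Suc.IH) simp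
  then show ?case by simp
qed simp

lemma has_derivative_Dx:
  assumes "C_k_on (Suc k) S u" "(x, y) \<in> S"
  shows "((\<lambda>t. u (t, y)) has_real_derivative Dx S u (x, y)) (at x within {t. (t, y) \<in> S})"
proof -
  have "(\<lambda>t. u (t, y)) differentiable (at x within {t. (t, y) \<in> S})"
    using assms by (auto simp: partially_differentiable_on_def)
  then show ?thesis
    by (simp add: Dx_def has_real_derivative_iff_has_vector_derivative vector_derivative_works)
qed

lemma has_derivative_Dy:
  assumes "C_k_on (Suc k) S u" "(x, y) \<in> S"
  shows "((\<lambda>t. u (x, t)) has_real_derivative Dy S u (x, y)) (at y within {t. (x, t) \<in> S})"
proof -
  have "(\<lambda>t. u (x, t)) differentiable (at y within {t. (x, t) \<in> S})"
    using assms by (auto simp: partially_differentiable_on_def)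
  then show ?thesis
    by (simp add: Dy_def has_real_derivative_iff_has_vector_derivative vector_derivative_works)
qed

text \<open>At an isolated point of a section every number is a derivative, so \<open>Dx\<close> and \<open>Dy\<close> are junk there.\<close>

definition perfect_sections :: "(real \<times> real) set \<Rightarrow> bool" where
  "perfect_sections S \<longleftrightarrow> (\<forall>(x, y) \<in> S. at x within {t. (t, y) \<in> S} \<noteq> bot \<and>
     at y within {t. (x, t) \<in> S} \<noteq> bot)"

lemma Dx_eqI:
  assumes "perfect_sections S" "(x, y) \<in> S"
    and "((\<lambda>t. u (t, y)) has_real_derivative d) (at x within {t. (t, y) \<in> S})"
  shows "Dx S u (x, y) = d"
  using assms by (auto simp: Dx_def perfect_sections_def
      has_real_derivative_iff_has_vector_derivative intro!: vector_derivative_within)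

lemma Dy_eqI:
  assumes "perfect_sections S" "(x, y) \<in> S"
    and "((\<lambda>t. u (x, t)) has_real_derivative d) (at y within {t. (x, t) \<in> S})"
  shows "Dy S u (x, y) = d"
  using assms by (auto simp: Dy_def perfect_sections_def
      has_real_derivative_iff_has_vector_derivative intro!: vector_derivative_within)

text \<open>On perfect sections derivatives are unique, so candidates \<open>f\<close> and
  \<open>g\<close> for the partial derivatives coincide with \<open>Dx S u\<close> and
  \<open>Dy S u\<close> on \<open>S\<close>, and \<open>C_k_on\<close> sees nothing outside
  \<open>S\<close>.\<close>

lemma C_Suc_onI:
  assumes "perfect_sections S" "continuous_on S u"
    and x: "\<And>x y. (x, y) \<in> S \<Longrightarrow>
      ((\<lambda>t. u (t, y)) has_real_derivative f (x, y)) (at x within {t. (t, y) \<in> S})"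
    and y: "\<And>x y. (x, y) \<in> S \<Longrightarrow>
      ((\<lambda>t. u (x, t)) has_real_derivative g (x, y)) (at y within {t. (x, t) \<in> S})"
    and "C_k_on k S f" "C_k_on k S g"
  shows "C_k_on (Suc k) S u"
proof -
  have "f p = Dx S u p" "g p = Dy S u p" if "p \<in> S" for p
    using that Dx_eqI[OF assms(1) _ x] Dy_eqI[OF assms(1) _ y] by (cases p; auto)+
  then have "C_k_on k S (Dx S u)" "C_k_on k S (Dy S u)"
    using C_k_on_cong[OF _ assms(5)] C_k_on_cong[OF _ assms(6)] by blast+
  moreover have "partially_differentiable_on S u"
    using x y real_differentiable_def by (fastforce simp: partially_differentiable_on_def)
  ultimately show ?thesis using assms(2) by simp
qed

lemma
  assumes "perfect_sections S" "C_k_on (Suc k) S u" "C_k_on (Suc k) S v" "p \<in> S"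
  shows Dx_lincomb: "Dx S (\<lambda>p. \<alpha> * u p + \<beta> * v p) p = \<alpha> * Dx S u p + \<beta> * Dx S v p"
    and Dy_lincomb: "Dy S (\<lambda>p. \<alpha> * u p + \<beta> * v p) p = \<alpha> * Dy S u p + \<beta> * Dy S v p"
proof -
  obtain x y where p: "p = (x, y)" by force
  show "Dx S (\<lambda>p. \<alpha> * u p + \<beta> * v p) p = \<alpha> * Dx S u p + \<beta> * Dx S v p"
    unfolding p by (rule Dx_eqI) (use assms p in \<open>auto intro!: derivative_eq_intros
      has_derivative_Dx[OF assms(2)] has_derivative_Dx[OF assms(3)]\<close>)
  show "Dy S (\<lambda>p. \<alpha> * u p + \<beta> * v p) p = \<alpha> * Dy S u p + \<beta> * Dy S v p"
    unfolding p by (rule Dy_eqI) (use assms p in \<open>auto intro!: derivative_eq_intros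
      has_derivative_Dy[OF assms(2)] has_derivative_Dy[OF assms(3)]\<close>)
qed

lemma C_k_on_lincomb:
  assumes "perfect_sections S" "C_k_on k S u" "C_k_on k S v"
  shows "C_k_on k S (\<lambda>p. \<alpha> * u p + \<beta> * v p)"
  using assms
proof (induction k arbitrary: u v)
  case 0
  then show ?case by (auto intro!: continuous_intros)
next
  case (Suc k)
  show ?case
  proof (rule C_Suc_onI)
    show "continuous_on S (\<lambda>p. \<alpha> * u p + \<beta> * v p)"
      using Suc.prems by (auto intro!: continuous_intros)
    show "C_k_on k S (\<lambda>p. \<alpha> * Dx S u p + \<beta> * Dx S v p)"
      "C_k_on k S (\<lambda>p. \<alpha> * Dy S u p + \<beta> * Dy S v p)"
      using Suc by auto
  qed (use Suc.prems in \<open>auto intro!: derivative_eq_intros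
      has_derivative_Dx[OF Suc.prems(2)] has_derivative_Dx[OF Suc.prems(3)]
      has_derivative_Dy[OF Suc.prems(2)] has_derivative_Dy[OF Suc.prems(3)]\<close>)
qed

lemma
  assumes "perfect_sections S" "C_k_on k S u" "C_k_on k S v" "i \<le> k" "p \<in> S"
  shows Dx_funpow_lincomb: "(Dx S ^^ i) (\<lambda>p. \<alpha> * u p + \<beta> * v p) p
      = \<alpha> * (Dx S ^^ i) u p + \<beta> * (Dx S ^^ i) v p"
    and Dy_funpow_lincomb: "(Dy S ^^ i) (\<lambda>p. \<alpha> * u p + \<beta> * v p) p
      = \<alpha> * (Dy S ^^ i) u p + \<beta> * (Dy S ^^ i) v p"
proof -
  show "(Dx S ^^ i) (\<lambda>p. \<alpha> * u p + \<beta> * v p) p = \<alpha> * (Dx S ^^ i) u p + \<beta> * (Dx S ^^ i) v p"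
    using assms(4,5)
  proof (induction i arbitrary: p)
    case (Suc i)
    have "C_k_on (Suc (k - Suc i)) S ((Dx S ^^ i) u)" "C_k_on (Suc (k - Suc i)) S ((Dx S ^^ i) v)"
      using C_k_on_Dx[of i "k - i" S] assms(2,3) Suc.prems(1) by (simp_all add: Suc_diff_Suc del: C_k_on.simps)
    from Dx_lincomb[OF assms(1) this Suc.prems(2)] show ?case
      using Dx_cong[OF Suc.IH] Suc.prems by simp
  qed simp
  show "(Dy S ^^ i) (\<lambda>p. \<alpha> * u p + \<beta> * v p) p = \<alpha> * (Dy S ^^ i) u p + \<beta> * (Dy S ^^ i) v p"
    using assms(4,5)
  proof (induction i arbitrary: p)
    case (Suc i)
    have "C_k_on (Suc (k - Suc i)) S ((Dy S ^^ i) u)" "C_k_on (Suc (k - Suc i)) S ((Dy S ^^ i) v)"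
      using C_k_on_Dy[of i "k - i" S] assms(2,3) Suc.prems(1) by (simp_all add: Suc_diff_Suc del: C_k_on.simps)
    from Dy_lincomb[OF assms(1) this Suc.prems(2)] show ?case
      using Dy_cong[OF Suc.IH] Suc.prems by simp
  qed simp
qed

section \<open>Independence of the ambient set at interior points\<close>

lemma
  assumes "open W"
  shows open_section_x: "open {t. (t, y) \<in> W}" and open_section_y: "open {t. (x, t) \<in> W}"
proof -
  have "continuous_on UNIV (\<lambda>t. (t, y))" "continuous_on UNIV (\<lambda>t. (x, t))"
    by (intro continuous_intros)+
  from this[THEN open_vimage[OF assms]]
  show "open {t. (t, y) \<in> W}" "open {t. (x, t) \<in> W}" by (simp_all add: vimage_def)
qed

text \<open>On an open \<open>W\<close> contained in both sets the relative derivatives are the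
  ordinary ones. This moves derivatives between the closed rectangle, the union of the two halves
  and a single half.\<close>

lemma
  assumes "open W" "W \<subseteq> A" "W \<subseteq> B" "\<And>p. p \<in> W \<Longrightarrow> u p = v p" "p \<in> W"
  shows Dx_local: "Dx A u p = Dx B v p" and Dy_local: "Dy A u p = Dy B v p"
proof -
  obtain x y where p: "p = (x, y)" by force
  have *: "at x within {t. (t, y) \<in> C} = at x" "at y within {t. (x, t) \<in> C} = at y"
    if "W \<subseteq> C" for C
  proof -
    show "at x within {t. (t, y) \<in> C} = at x" "at y within {t. (x, t) \<in> C} = at y"
      using that assms(5) p open_section_x[OF assms(1)] open_section_y[OF assms(1)]
      by (auto intro!: at_within_open_subset[of x "{t. (t, y) \<in> W}"]
          at_within_open_subset[of y "{t. (x, t) \<in> W}"])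
  qed
  have "\<forall>\<^sub>F t in nhds x. (t, y) \<in> W" "\<forall>\<^sub>F t in nhds y. (x, t) \<in> W"
    using eventually_nhds_in_open[OF open_section_x[OF assms(1)], of x y]
      eventually_nhds_in_open[OF open_section_y[OF assms(1)], of y x] assms(5) p by simp_all
  then have "\<forall>\<^sub>F t in nhds x. u (t, y) = v (t, y)" "\<forall>\<^sub>F t in nhds y. u (x, t) = v (x, t)"
    by (auto elim!: eventually_mono simp: assms(4))
  then show "Dx A u p = Dx B v p" "Dy A u p = Dy B v p"
    unfolding Dx_def Dy_def p using *[OF assms(2)] *[OF assms(3)]
    by (auto intro!: vector_derivative_cong_eq)
qed

lemma perfect_sections_open:
  assumes "open W" shows "perfect_sections W"
  unfolding perfect_sections_def
proof (intro ballI, clarsimp, intro conjI)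
  fix x y assume xy: "(x, y) \<in> W"
  show "at x within {t. (t, y) \<in> W} \<noteq> bot" "at y within {t. (x, t) \<in> W} \<noteq> bot"
    using xy at_within_open[OF _ open_section_x[OF assms], of x y]
      at_within_open[OF _ open_section_y[OF assms], of y x] by auto
qed

lemma C_k_on_open_subset:
  assumes "open W" "W \<subseteq> A" "C_k_on k A u"
  shows "C_k_on k W u"
  using assms(3)
proof (induction k arbitrary: u)
  case 0
  then show ?case using assms(2) continuous_on_subset by auto
next
  case (Suc k)
  show ?case
  proof (rule C_Suc_onI)
    show "perfect_sections W" using assms(1) by (rule perfect_sections_open)
    show "continuous_on W u" using Suc.prems assms(2) continuous_on_subset by auto
    fix x y assume xy: "(x, y) \<in> W"
    show "((\<lambda>t. u (t, y)) has_real_derivative Dx A u (x, y)) (at x within {t. (t, y) \<in> W})"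
      by (rule has_field_derivative_subset[OF has_derivative_Dx[OF Suc.prems]])
        (use xy assms(2) in auto)
    show "((\<lambda>t. u (x, t)) has_real_derivative Dy A u (x, y)) (at y within {t. (x, t) \<in> W})"
      by (rule has_field_derivative_subset[OF has_derivative_Dy[OF Suc.prems]])
        (use xy assms(2) in auto)
  qed (use Suc in auto)
qed

subsection \<open>Commuting derivatives on closed rectangles\<close>

lemma section_Times:
  "y \<in> Y \<Longrightarrow> {t. (t, y) \<in> X \<times> Y} = X" "x \<in> X \<Longrightarrow> {t. (x, t) \<in> X \<times> Y} = Y"
  by auto

lemma perfect_sections_Icc:
  fixes a b c d :: real
  assumes "a < b" "c < d"
  shows "perfect_sections ({a..b} \<times> {c..d})"
proof -
  have *: "at x within {p..q} \<noteq> bot" if "x \<in> {p..q}" "p < q" for x p q :: real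
    using that by (simp only: trivial_limit_within islimpt_Icc not_not)
  show ?thesis unfolding perfect_sections_def using * assms by (auto simp only: section_Times)
qed

text \<open>Differentiating \<open>f (x, y) = f (a, y) + (\<integral>\<^sub>a\<^sup>x Dx f)\<close> in \<open>y\<close> under the integral sign and then in
  \<open>x\<close> works up to the boundary, unlike the usual argument with second differences.\<close>

lemma Dx_Dy_commute:
  fixes a b c d :: real
  assumes "a < b" "c < d" and f: "C_k_on 2 ({a..b} \<times> {c..d}) f" and "p \<in> {a..b} \<times> {c..d}"
  shows "Dx ({a..b} \<times> {c..d}) (Dy ({a..b} \<times> {c..d}) f) p =
    Dy ({a..b} \<times> {c..d}) (Dx ({a..b} \<times> {c..d}) f) p"
proof -
  define T where "T = {a..b} \<times> {c..d}"
  have T: "perfect_sections T" unfolding T_def using assms by (intro perfect_sections_Icc)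
  obtain x0 y0 where p: "p = (x0, y0)" "x0 \<in> {a..b}" "y0 \<in> {c..d}" using assms(4) by auto
  have sec: "y \<in> {c..d} \<Longrightarrow> {t. (t, y) \<in> T} = {a..b}" "x \<in> {a..b} \<Longrightarrow> {t. (x, t) \<in> T} = {c..d}" for x y
    by (auto simp: T_def)
  have f1: "C_k_on (Suc (Suc 0)) T f" using f by (simp add: T_def numeral_2_eq_2)
  have fx: "C_k_on (Suc 0) T (Dx T f)" using f1 by simp
  have contyx: "continuous_on T (Dy T (Dx T f))" using fx by simp
  have contx: "continuous_on T (Dx T f)" using fx by simp
  have int_x: "(\<lambda>t. g (t, y)) integrable_on {a'..b'}"
    if "continuous_on T g" "y \<in> {c..d}" "{a'..b'} \<subseteq> {a..b}" for g :: "real \<times> real \<Rightarrow> real" and y a' b'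
  proof (rule integrable_continuous_real)
    show "continuous_on {a'..b'} (\<lambda>t. g (t, y))"
      by (rule continuous_on_compose2[OF that(1)]) (use that in \<open>auto simp: T_def intro!: continuous_intros\<close>)
  qed
  have Dyf: "Dy T f (x, y0) = Dy T f (a, y0) + integral {a..x} (\<lambda>t. Dy T (Dx T f) (t, y0))"
    if x: "x \<in> {a..b}" for x
  proof (rule Dy_eqI[OF T])
    show "(x, y0) \<in> T" using p x by (simp add: T_def)
    have "((\<lambda>y. integral (cbox a x) (\<lambda>t. Dx T f (t, y))) has_field_derivative
        integral (cbox a x) (\<lambda>t. Dy T (Dx T f) (t, y0))) (at y0 within {c..d})"
    proof (rule leibniz_rule_field_derivative)
      fix y t assume yt: "y \<in> {c..d}" "t \<in> cbox a x"
      then show "((\<lambda>y. Dx T f (t, y)) has_real_derivative Dy T (Dx T f) (t, y)) (at y within {c..d})"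
        using has_derivative_Dy[OF fx, of t y] x by (simp add: sec) (simp add: T_def)
    next
      fix y assume "y \<in> {c..d}"
      then show "(\<lambda>t. Dx T f (t, y)) integrable_on cbox a x"
        using int_x[OF contx, of y a x] x by simp
    next
      show "continuous_on ({c..d} \<times> cbox a x) (\<lambda>(y, t). Dy T (Dx T f) (t, y))"
        unfolding split_beta
        by (rule continuous_on_compose2[OF contyx]) (use x in \<open>auto simp: T_def intro!: continuous_intros\<close>)
    qed (use p in auto)
    moreover have "((\<lambda>y. f (a, y)) has_real_derivative Dy T f (a, y0)) (at y0 within {c..d})"
      using has_derivative_Dy[OF f1, of a y0] p assms(1) by (simp add: sec) (simp add: T_def)
    ultimately have D: "((\<lambda>y. f (a, y) + integral (cbox a x) (\<lambda>t. Dx T f (t, y))) has_real_derivative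
        Dy T f (a, y0) + integral (cbox a x) (\<lambda>t. Dy T (Dx T f) (t, y0))) (at y0 within {c..d})"
      by (rule DERIV_add[rotated])
    have eq: "f (x, y) = f (a, y) + integral {a..x} (\<lambda>t. Dx T f (t, y))" if y: "y \<in> {c..d}" for y
    proof -
      have "((\<lambda>t. Dx T f (t, y)) has_integral f (x, y) - f (a, y)) {a..x}"
      proof (rule fundamental_theorem_of_calculus)
        fix t assume t: "t \<in> {a..x}"
        then have "((\<lambda>t. f (t, y)) has_real_derivative Dx T f (t, y)) (at t within {a..b})"
          using has_derivative_Dx[OF f1, of t y] x y by (simp add: sec) (simp add: T_def)
        then show "((\<lambda>t. f (t, y)) has_vector_derivative Dx T f (t, y)) (at t within {a..x})"
          using x has_field_derivative_subset[of _ _ _ "{a..b}" "{a..x}"]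
          by (simp flip: has_real_derivative_iff_has_vector_derivative)
      qed (use x in auto)
      then show ?thesis by (simp add: integral_unique)
    qed
    show "((\<lambda>y. f (x, y)) has_real_derivative
        Dy T f (a, y0) + integral {a..x} (\<lambda>t. Dy T (Dx T f) (t, y0))) (at y0 within {t. (x, t) \<in> T})"
      unfolding sec(2)[OF x]
      by (rule has_field_derivative_transform_within[OF D[unfolded box_real], where d = 1]) (use p eq[symmetric] in auto)
  qed
  have "continuous_on {a..b} (\<lambda>t. Dy T (Dx T f) (t, y0))"
    by (rule continuous_on_compose2[OF contyx]) (use p in \<open>auto simp: T_def intro!: continuous_intros\<close>)
  from integral_has_real_derivative[OF this p(2)]
  have D: "((\<lambda>x. Dy T f (a, y0) + integral {a..x} (\<lambda>t. Dy T (Dx T f) (t, y0))) has_real_derivative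
      Dy T (Dx T f) (x0, y0)) (at x0 within {a..b})"
    by (auto intro!: derivative_eq_intros)
  have "Dx T (Dy T f) (x0, y0) = Dy T (Dx T f) (x0, y0)"
  proof (rule Dx_eqI[OF T])
    show "(x0, y0) \<in> T" using p by (simp add: T_def)
    show "((\<lambda>x. Dy T f (x, y0)) has_real_derivative Dy T (Dx T f) (x0, y0))
        (at x0 within {t. (t, y0) \<in> T})"
      unfolding sec(1)[OF p(3)]
      by (rule has_field_derivative_transform_within[OF D, where d = 1]) (use p Dyf[symmetric] in auto)
  qed
  then show ?thesis by (simp add: p T_def)
qed

lemma Dx_funpow_Dy_commute:
  fixes a b c d :: real
  defines "T \<equiv> {a..b} \<times> {c..d}"
  assumes "a < b" "c < d" and f: "C_k_on (Suc i) T f" and "p \<in> T"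
  shows "(Dx T ^^ i) (Dy T f) p = Dy T ((Dx T ^^ i) f) p"
  using f assms(5)
proof (induction i arbitrary: p)
  case (Suc i)
  have "C_k_on 2 T ((Dx T ^^ i) f)" using Suc.prems(1) C_k_on_Dx[of i 2 T f] by (simp del: C_k_on.simps)
  then have "Dx T (Dy T ((Dx T ^^ i) f)) p = Dy T (Dx T ((Dx T ^^ i) f)) p"
    using Dx_Dy_commute assms Suc.prems(2) by simp
  moreover have "Dx T ((Dx T ^^ i) (Dy T f)) p = Dx T (Dy T ((Dx T ^^ i) f)) p"
    by (rule Dx_cong[OF Suc.IH Suc.prems(2)]) (use C_k_on_Suc_D[OF Suc.prems(1)] in auto)
  ultimately show ?case by simp
qed simp

section \<open>The second-order factors with a constant sign\<close>

text \<open>With a parameter in place of \<open>sgn y\<close> the factor has constant coefficients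
  on the whole of \<open>S\<close>, so that it can be iterated on the closed rectangle although the
  equation is used on one half only.\<close>

definition wave_factor :: "(real \<times> real) set \<Rightarrow> real \<Rightarrow> real \<Rightarrow> (real \<times> real \<Rightarrow> real) \<Rightarrow> real \<times> real \<Rightarrow> real" where
  "wave_factor S \<sigma> b u p = b\<^sup>2 * Dx S (Dx S u) p + \<sigma> * Dy S (Dy S u) p"

lemma C_k_on_wave_factor:
  assumes "perfect_sections S" "C_k_on (Suc (Suc k)) S u"
  shows "C_k_on k S (wave_factor S \<sigma> b u)"
  using assms unfolding wave_factor_def[abs_def] by (intro C_k_on_lincomb) auto

lemma wave_factor_local:
  assumes "open W" "W \<subseteq> A" "W \<subseteq> B" "\<And>p. p \<in> W \<Longrightarrow> u p = v p" "p \<in> W"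
  shows "wave_factor A \<sigma> b u p = wave_factor B \<sigma> b v p"
proof -
  note * = Dx_local[OF assms(1-4)] Dy_local[OF assms(1-4)]
  show ?thesis
    using Dx_local[OF assms(1-3) *(1) assms(5)] Dy_local[OF assms(1-3) *(2) assms(5)]
    by (simp add: wave_factor_def)
qed

text \<open>After commuting derivatives, order \<open>2 * s\<close> of the factor at the edge is a
  multiple of order \<open>2 * Suc s\<close> of \<open>u\<close>, zero by the next boundary
  condition, plus second derivatives along the edge of a function that vanishes there. One condition
  is used up, hence \<open>s \<le> m\<close> for \<open>u\<close> and \<open>s < m\<close> for its
  image.\<close>

lemma Dx_funpow_wave_factor_eq_0:
  fixes a b c d :: real
  defines "T \<equiv> {a..b} \<times> {c..d}"
  assumes "a < b" "c < d" and u: "C_k_on (2 * m) T u"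
    and bdry: "\<And>s y. s \<le> m \<Longrightarrow> y \<in> {c..d} \<Longrightarrow> (Dx T ^^ (2 * s)) u (x, y) = 0"
    and x: "x \<in> {a..b}" and "s < m" and y: "y \<in> {c..d}"
  shows "(Dx T ^^ (2 * s)) (wave_factor T \<sigma> \<beta> u) (x, y) = 0"
proof -
  have T: "perfect_sections T" unfolding T_def using assms by (intro perfect_sections_Icc)
  have p: "(x, y) \<in> T" using x y by (simp add: T_def)
  have u2: "C_k_on (Suc (Suc (2 * s))) T u" using \<open>s < m\<close> by (intro C_k_on_mono[OF u]) simp
  then have "(Dx T ^^ (2 * s)) (wave_factor T \<sigma> \<beta> u) (x, y) =
      \<beta>\<^sup>2 * (Dx T ^^ (2 * s)) (Dx T (Dx T u)) (x, y) + \<sigma> * (Dx T ^^ (2 * s)) (Dy T (Dy T u)) (x, y)"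
    unfolding wave_factor_def[abs_def] using p by (intro Dx_funpow_lincomb[OF T, of "2 * s"]) auto
  also have "(Dx T ^^ (2 * s)) (Dx T (Dx T u)) (x, y) = (Dx T ^^ (2 * Suc s)) u (x, y)"
    by (simp add: funpow_swap1)
  also have "\<dots> = 0" using \<open>s < m\<close> y by (intro bdry) auto
  also have "(Dx T ^^ (2 * s)) (Dy T (Dy T u)) (x, y) = Dy T (Dy T ((Dx T ^^ (2 * s)) u)) (x, y)"
  proof -
    have "(Dx T ^^ (2 * s)) (Dy T u) q = Dy T ((Dx T ^^ (2 * s)) u) q" if "q \<in> T" for q
      using Dx_funpow_Dy_commute[of a b c d "2 * s" u q] that assms(2,3) C_k_on_Suc_D[OF u2]
      by (simp add: T_def del: C_k_on.simps)
    from Dy_cong[OF this p] show ?thesis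
      using Dx_funpow_Dy_commute[of a b c d "2 * s" "Dy T u" "(x, y)"] p assms(2,3) u2
      by (simp add: T_def)
  qed
  also have "\<dots> = 0"
  proof -
    have *: "Dy T g (x, y) = 0" if "\<And>y. y \<in> {c..d} \<Longrightarrow> g (x, y) = 0" "y \<in> {c..d}" for g y
    proof (rule Dy_eqI[OF T])
      have "((\<lambda>t. g (x, t)) has_real_derivative 0) (at y within {c..d})"
        by (rule has_field_derivative_transform_within[of "\<lambda>_. 0" 0 y _ 1]) (use that in auto)
      moreover have "{t. (x, t) \<in> T} = {c..d}" using x by (auto simp: T_def)
      ultimately show "((\<lambda>t. g (x, t)) has_real_derivative 0) (at y within {t. (x, t) \<in> T})" by simp
    qed (use that x in \<open>simp add: T_def\<close>)
    show ?thesis using \<open>s < m\<close> by (intro * bdry y) auto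
  qed
  finally show ?thesis by simp
qed

subsection \<open>Sine coefficients\<close>

definition sine_coeff :: "nat \<Rightarrow> (real \<times> real \<Rightarrow> real) \<Rightarrow> real \<Rightarrow> real" where
  "sine_coeff k u y = integral {0..1} (\<lambda>x. u (x, y) * sin (pi * real k * x))"

abbreviation rect :: "(real \<times> real) set" where
  "rect \<equiv> {0..1} \<times> {-1..1}"

lemma perfect_sections_rect: "perfect_sections rect"
  by (intro perfect_sections_Icc) auto

lemma has_derivative_rect:
  assumes "C_k_on (Suc k) rect u" "x \<in> {0..1}" "y \<in> {-1..1}"
  shows "((\<lambda>t. u (t, y)) has_real_derivative Dx rect u (x, y)) (at x within {0..1})"
    and "((\<lambda>t. u (x, t)) has_real_derivative Dy rect u (x, y)) (at y within {-1..1})"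
proof -
  from assms(2,3) have "(x, y) \<in> rect" by simp
  from has_derivative_Dx[OF assms(1) this] has_derivative_Dy[OF assms(1) this]
  show "((\<lambda>t. u (t, y)) has_real_derivative Dx rect u (x, y)) (at x within {0..1})"
    and "((\<lambda>t. u (x, t)) has_real_derivative Dy rect u (x, y)) (at y within {-1..1})"
    unfolding section_Times(1)[OF assms(3)] section_Times(2)[OF assms(2)] by auto
qed

lemma continuous_on_rect_x:
  assumes "continuous_on rect g" "y \<in> {-1..1}"
  shows "continuous_on {0..1} (\<lambda>x. g (x, y))"
  by (rule continuous_on_compose2[OF assms(1)]) (use assms(2) in \<open>auto intro!: continuous_intros\<close>)

lemma sine_coeff_has_derivative:
  assumes "C_k_on (Suc i) rect u" "y \<in> {-1..1}"
  shows "(sine_coeff k u has_real_derivative sine_coeff k (Dy rect u) y) (at y within {-1..1})"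
proof -
  have c: "continuous_on rect u" "continuous_on rect (Dy rect u)"
    using assms(1) C_k_on_imp_continuous_on by auto
  have "((\<lambda>y. integral (cbox 0 1) (\<lambda>x. u (x, y) * sin (pi * real k * x))) has_real_derivative
      integral (cbox 0 1) (\<lambda>x. Dy rect u (x, y) * sin (pi * real k * x))) (at y within {-1..1})"
  proof (rule leibniz_rule_field_derivative)
    fix y t :: real assume "y \<in> {-1..1}" "t \<in> cbox 0 1"
    then show "((\<lambda>y. u (t, y) * sin (pi * real k * t)) has_real_derivative
        Dy rect u (t, y) * sin (pi * real k * t)) (at y within {-1..1})"
      using has_derivative_rect(2)[OF assms(1), of t y] by (intro DERIV_cmult_right) auto
  next
    fix y :: real assume "y \<in> {-1..1}"
    then show "(\<lambda>x. u (x, y) * sin (pi * real k * x)) integrable_on cbox 0 1"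
      unfolding box_real
      by (intro integrable_continuous_real continuous_intros continuous_on_rect_x[OF c(1)])
  next
    have "continuous_on ({-1..1} \<times> cbox 0 1) (\<lambda>p. Dy rect u (snd p, fst p))"
      by (rule continuous_on_compose2[OF c(2)]) (auto intro!: continuous_intros)
    then show "continuous_on ({-1..1} \<times> cbox 0 1) (\<lambda>(y, x). Dy rect u (x, y) * sin (pi * real k * x))"
      unfolding split_beta by (intro continuous_intros)
  qed (use assms in auto)
  then show ?thesis by (simp add: sine_coeff_def[abs_def])
qed

lemma continuous_on_sine_coeff:
  assumes "continuous_on rect u"
  shows "continuous_on {-1..1} (sine_coeff k u)"
proof -
  have "continuous_on ({-1..1} \<times> cbox 0 1) (\<lambda>p. u (snd p, fst p))"
    by (rule continuous_on_compose2[OF assms]) (auto intro!: continuous_intros)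
  then have "continuous_on ({-1..1} \<times> cbox 0 1) (\<lambda>(y, x). u (x, y) * sin (pi * real k * x))"
    unfolding split_beta by (intro continuous_intros)
  from integral_continuous_on_param[OF this] show ?thesis by (simp add: sine_coeff_def[abs_def])
qed

text \<open>Fubini, needed because the equation is integrated in y before the sine coefficient is
  taken.\<close>

lemma integral_sine_coeff:
  assumes "continuous_on rect u" "-1 \<le> p" "q \<le> 1"
  shows "integral {0..1} (\<lambda>x. integral {p..q} (\<lambda>y. u (x, y)) * sin (pi * real k * x)) =
    integral {p..q} (sine_coeff k u)"
proof -
  have "continuous_on (cbox (0, p) (1, q)) u"
    using assms by (intro continuous_on_subset[OF assms(1)]) (auto simp: cbox_Pair_eq)
  then have "continuous_on (cbox (0, p) (1, q)) (\<lambda>(x, y). u (x, y) * sin (pi * real k * x))"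
    unfolding split_beta by (auto intro!: continuous_intros)
  from integral_swap_continuous[OF this] show ?thesis
    by (simp add: sine_coeff_def[abs_def])
qed

text \<open>The second derivatives of \<open>v\<close> need not be integrable up to the boundary, so the equation is
  first integrated over \<open>[c\<^sub>1, z]\<close> in \<open>y\<close>: the result \<open>\<Phi>\<close> has a second derivative in \<open>x\<close> that extends
  continuously to \<open>[0, 1]\<close>.\<close>

lemma sine_coeff_wave_factor:
  fixes c d :: real
  defines "W \<equiv> {0<..<1} \<times> {c<..<d}"
  assumes v: "C_k_on 1 rect v" "C_k_on 2 W v" and cd: "-1 \<le> c" "d \<le> 1"
    and bdry: "\<And>y. y \<in> {c<..<d} \<Longrightarrow> v (0, y) = 0 \<and> v (1, y) = 0"
    and h: "continuous_on rect h" and eq: "\<And>p. p \<in> W \<Longrightarrow> wave_factor rect \<sigma> b v p = h p"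
    and \<sigma>: "\<sigma>\<^sup>2 = 1" and y: "y \<in> {c<..<d}"
  shows "(sine_coeff k (Dy rect v) has_real_derivative
    \<sigma> * ((pi * real k * b)\<^sup>2 * sine_coeff k v y + sine_coeff k h y)) (at y)"
proof -
  define \<mu> where "\<mu> = pi * real k"
  define G where "G = sine_coeff k (Dy rect v)"
  define F where "F = (\<lambda>y. \<sigma> * ((pi * real k * b)\<^sup>2 * sine_coeff k v y + sine_coeff k h y))"
  have W: "open W" "W \<subseteq> rect" "W \<subseteq> W"
    unfolding W_def using cd by (auto intro: open_Times)
  have cv: "continuous_on rect v" "continuous_on rect (Dx rect v)" "continuous_on rect (Dy rect v)"
    using v(1) by auto
  have v1: "C_k_on (Suc 0) rect v" using v(1) by simp
  have "C_k_on (Suc 0) W (Dx W v)" "C_k_on (Suc 0) W (Dy W v)" using v(2) by (auto simp: numeral_2_eq_2)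
  then have vW: "C_k_on (Suc 0) W (Dx rect v)" "C_k_on (Suc 0) W (Dy rect v)"
    using Dx_local[OF W(1) W(3) W(2), of v v] Dy_local[OF W(1) W(3) W(2), of v v] C_k_on_cong by blast+
  have secW: "{t. (t, y) \<in> W} = {0<..<1}" "{t. (x, t) \<in> W} = {c<..<d}"
    if "x \<in> {0<..<1}" "y \<in> {c<..<d}" for x y
    using that by (auto simp: W_def)
  have DW: "Dx W (Dx rect v) p = Dx rect (Dx rect v) p" "Dy W (Dy rect v) p = Dy rect (Dy rect v) p"
    if "p \<in> W" for p
    using Dx_local[OF W(1) W(3) W(2), of "Dx rect v"] Dy_local[OF W(1) W(3) W(2), of "Dy rect v"] that by auto
  have Dxx: "((\<lambda>t. Dx rect v (t, y)) has_real_derivative Dx rect (Dx rect v) (x, y)) (at x within {0<..<1})"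
    and Dyy: "((\<lambda>t. Dy rect v (x, t)) has_real_derivative Dy rect (Dy rect v) (x, y)) (at y within {c<..<d})"
    if "x \<in> {0<..<1}" "y \<in> {c<..<d}" for x y
    using has_derivative_Dx[OF vW(1), of x y] has_derivative_Dy[OF vW(2), of x y] that secW[OF that]
      DW[of "(x, y)"] by (auto simp: W_def)
  have "continuous_on W (Dx W (Dx rect v))" "continuous_on W (Dy W (Dy rect v))" using vW by auto
  then have cW: "continuous_on W (Dx rect (Dx rect v))" "continuous_on W (Dy rect (Dy rect v))"
    using DW continuous_on_cong by (metis (no_types, lifting))+
  \<comment> \<open>At \<open>c\<close> and \<open>d\<close> themselves second derivatives are not
    controlled, so integration starts at a point strictly inside. As \<open>y\<close> is interior to
    \<open>{c1..d1}\<close>, a derivative within that interval is a full one.\<close>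
  obtain c1 d1 where c1: "c < c1" "c1 < y" and d1: "y < d1" "d1 < d"
    using y dense[of c y] dense[of y d] by auto
  \<comment> \<open>The differential equation in integrated form; as \<open>F\<close> is continuous,
    differentiating in \<open>z\<close> returns it.\<close>
  have main: "G z - G c1 = integral {c1..z} F" if z: "z \<in> {c1..d1}" for z
  proof -
    define \<Phi> where "\<Phi> = (\<lambda>x. integral {c1..z} (\<lambda>y. v (x, y)))"
    define \<Phi>1 where "\<Phi>1 = (\<lambda>x. integral {c1..z} (\<lambda>y. Dx rect v (x, y)))"
    define H where "H = (\<lambda>x. integral {c1..z} (\<lambda>y. h (x, y)))"
    have sub: "{c1..z} \<subseteq> {c<..<d}" "{c1..z} \<subseteq> {-1..1}" "z \<in> {-1..1}" "c1 \<in> {-1..1}"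
      using z c1 d1 cd by auto
    have slice: "continuous_on {c1..z} (\<lambda>y. g (x, y))" if "continuous_on rect g" "x \<in> {0..1}" for g x
      by (rule continuous_on_compose2[OF that(1)]) (use that sub in \<open>auto intro!: continuous_intros\<close>)
    have sliceW: "continuous_on {c1..z} (\<lambda>y. g (x, y))" if "continuous_on W g" "x \<in> {0<..<1}" for g x
      by (rule continuous_on_compose2[OF that(1)]) (use that sub in \<open>auto simp: W_def intro!: continuous_intros\<close>)
    have \<Phi>': "(\<Phi> has_real_derivative \<Phi>1 x) (at x within {0..1})" if "x \<in> {0..1}" for x
    proof -
      have "((\<lambda>x. integral (cbox c1 z) (\<lambda>y. v (x, y))) has_real_derivative
          integral (cbox c1 z) (\<lambda>y. Dx rect v (x, y))) (at x within {0..1})"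
      proof (rule leibniz_rule_field_derivative)
        show "continuous_on ({0..1} \<times> cbox c1 z) (\<lambda>(x, y). Dx rect v (x, y))"
          using sub by (auto intro!: continuous_on_subset[OF cv(2)])
      qed (use that sub has_derivative_rect(1)[OF v1] slice[OF cv(1)]
          in \<open>auto intro!: integrable_continuous_real\<close>)
      then show ?thesis by (simp add: \<Phi>_def \<Phi>1_def)
    qed
    have "continuous_on ({0..1} \<times> cbox c1 z) (\<lambda>(x, y). Dx rect v (x, y))"
      using sub by (auto intro!: continuous_on_subset[OF cv(2)])
    from integral_continuous_on_param[OF this] have c\<Phi>1: "continuous_on {0..1} \<Phi>1"
      by (simp add: \<Phi>1_def)
    have c\<Phi>: "continuous_on {0..1} \<Phi>"
      by (rule DERIV_continuous_on[OF \<Phi>'])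
    \<comment> \<open>The equation replaces the integral of the second x-derivative by
      \<open>H\<close> and an increment of \<open>Dy rect v\<close>, both continuous up to x = 0 and
      x = 1.\<close>
    have \<Phi>1': "((\<lambda>x. b\<^sup>2 * \<Phi>1 x) has_real_derivative H x - \<sigma> * (Dy rect v (x, z) - Dy rect v (x, c1))) (at x)"
      if x: "x \<in> {0<..<1}" for x
    proof -
      have "((\<lambda>x. integral (cbox c1 z) (\<lambda>y. Dx rect v (x, y))) has_real_derivative
          integral (cbox c1 z) (\<lambda>y. Dx rect (Dx rect v) (x, y))) (at x within {0<..<1})"
      proof (rule leibniz_rule_field_derivative)
        show "continuous_on ({0<..<1} \<times> cbox c1 z) (\<lambda>(x, y). Dx rect (Dx rect v) (x, y))"
          using sub by (auto simp: W_def intro!: continuous_on_subset[OF cW(1)])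
      next
        fix x y :: real assume "x \<in> {0<..<1}" "y \<in> cbox c1 z"
        then show "((\<lambda>x. Dx rect v (x, y)) has_real_derivative Dx rect (Dx rect v) (x, y)) (at x within {0<..<1})"
          using Dxx sub by auto
      next
        fix x :: real assume "x \<in> {0<..<1}"
        then show "(\<lambda>y. Dx rect v (x, y)) integrable_on cbox c1 z"
          using slice[OF cv(2), of x] by (auto intro!: integrable_continuous_real)
      qed (use x in auto)
      then have "(\<Phi>1 has_real_derivative integral {c1..z} (\<lambda>y. Dx rect (Dx rect v) (x, y))) (at x)"
        using x at_within_open[of x "{0<..<1}"] by (simp add: \<Phi>1_def)
      then have *: "((\<lambda>x. b\<^sup>2 * \<Phi>1 x) has_real_derivative
          b\<^sup>2 * integral {c1..z} (\<lambda>y. Dx rect (Dx rect v) (x, y))) (at x)"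
        by (rule DERIV_cmult)
      have "((\<lambda>y. Dy rect (Dy rect v) (x, y)) has_integral Dy rect v (x, z) - Dy rect v (x, c1)) {c1..z}"
      proof (rule fundamental_theorem_of_calculus)
        fix t assume "t \<in> {c1..z}"
        then show "((\<lambda>t. Dy rect v (x, t)) has_vector_derivative Dy rect (Dy rect v) (x, t)) (at t within {c1..z})"
          using has_field_derivative_subset[OF Dyy[OF x] sub(1)] sub(1)
          by (auto simp flip: has_real_derivative_iff_has_vector_derivative)
      qed (use z in auto)
      then have "((\<lambda>y. h (x, y) - \<sigma> * Dy rect (Dy rect v) (x, y)) has_integral
          H x - \<sigma> * (Dy rect v (x, z) - Dy rect v (x, c1))) {c1..z}"
        unfolding H_def using x slice[OF h, of x]
        by (intro has_integral_diff has_integral_mult_right integrable_integral integrable_continuous_real) auto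
      then have "integral {c1..z} (\<lambda>y. h (x, y) - \<sigma> * Dy rect (Dy rect v) (x, y)) =
          H x - \<sigma> * (Dy rect v (x, z) - Dy rect v (x, c1))"
        by (rule integral_unique)
      moreover have "integral {c1..z} (\<lambda>y. h (x, y) - \<sigma> * Dy rect (Dy rect v) (x, y)) =
          integral {c1..z} (\<lambda>y. b\<^sup>2 * Dx rect (Dx rect v) (x, y))"
        using eq x sub(1) by (intro integral_cong) (force simp: W_def wave_factor_def)
      ultimately show ?thesis using * by simp
    qed
    \<comment> \<open>Green's expression b^2 (\<Phi>' S - \<Phi> S') with S = sin(\<mu> x), an
      antiderivative of the integrated equation weighted by S. It is continuous on [0, 1], its
      derivative is known only inside, and it vanishes at both ends because \<Phi> and S do.\<close>
    define Q where "Q = (\<lambda>x. b\<^sup>2 * \<Phi>1 x * sin (\<mu> * x) - \<mu> * b\<^sup>2 * (\<Phi> x * cos (\<mu> * x)))"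
    have I1: "((\<lambda>x. (H x - \<sigma> * (Dy rect v (x, z) - Dy rect v (x, c1))) * sin (\<mu> * x)
        + (\<mu> * b)\<^sup>2 * (\<Phi> x * sin (\<mu> * x))) has_integral Q 1 - Q 0) {0..1}"
    proof (rule fundamental_theorem_of_calculus_interior)
      show "continuous_on {0..1} Q" unfolding Q_def using c\<Phi> c\<Phi>1 by (intro continuous_intros)
      fix x :: real assume x: "x \<in> {0<..<1}"
      have "(\<Phi> has_real_derivative \<Phi>1 x) (at x)"
        using \<Phi>'[of x] x at_within_interior[of x "{0..1}"] by (simp add: interior_atLeastAtMost_real)
      then have D1: "((\<lambda>x. \<mu> * b\<^sup>2 * (\<Phi> x * cos (\<mu> * x))) has_real_derivative
          \<mu> * b\<^sup>2 * (\<Phi>1 x * cos (\<mu> * x) + (- sin (\<mu> * x) * \<mu>) * \<Phi> x)) (at x)"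
        by (intro DERIV_cmult DERIV_mult) (auto intro!: derivative_eq_intros)
      have D2: "((\<lambda>x. b\<^sup>2 * \<Phi>1 x * sin (\<mu> * x)) has_real_derivative
          (H x - \<sigma> * (Dy rect v (x, z) - Dy rect v (x, c1))) * sin (\<mu> * x)
          + (cos (\<mu> * x) * \<mu>) * (b\<^sup>2 * \<Phi>1 x)) (at x)"
        by (rule DERIV_mult[OF \<Phi>1'[OF x]]) (auto intro!: derivative_eq_intros)
      have "(Q has_real_derivative (H x - \<sigma> * (Dy rect v (x, z) - Dy rect v (x, c1))) * sin (\<mu> * x)
          + (\<mu> * b)\<^sup>2 * (\<Phi> x * sin (\<mu> * x))) (at x)"
        unfolding Q_def by (rule DERIV_cong[OF DERIV_diff[OF D2 D1]]) (simp add: algebra_simps power2_eq_square)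
      then show "(Q has_vector_derivative (H x - \<sigma> * (Dy rect v (x, z) - Dy rect v (x, c1))) * sin (\<mu> * x)
          + (\<mu> * b)\<^sup>2 * (\<Phi> x * sin (\<mu> * x))) (at x)"
        by (simp add: has_real_derivative_iff_has_vector_derivative)
    qed simp
    have Q0: "Q 1 - Q 0 = 0"
    proof -
      have "\<Phi> x = integral {c1..z} (\<lambda>_. 0)" if "x = 0 \<or> x = 1" for x
        unfolding \<Phi>_def by (rule integral_cong) (use that bdry sub(1) in blast)
      then have "\<Phi> 0 = 0" "\<Phi> 1 = 0" by simp_all
      moreover have "sin \<mu> = 0" unfolding \<mu>_def using sin_npi2[of k] by (simp add: mult.commute)
      ultimately show ?thesis by (simp add: Q_def)
    qed
    have I2: "((\<lambda>x. (H x - \<sigma> * (Dy rect v (x, z) - Dy rect v (x, c1))) * sin (\<mu> * x)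
        + (\<mu> * b)\<^sup>2 * (\<Phi> x * sin (\<mu> * x))) has_integral
        (integral {c1..z} (sine_coeff k h) - \<sigma> * (G z - G c1)) + (\<mu> * b)\<^sup>2 * integral {c1..z} (sine_coeff k v)) {0..1}"
    proof -
      have int: "((\<lambda>x. g x * sin (\<mu> * x)) has_integral integral {0..1} (\<lambda>x. g x * sin (\<mu> * x))) {0..1}"
        if "continuous_on {0..1} g" for g :: "real \<Rightarrow> real"
        using that by (intro integrable_integral integrable_continuous_real continuous_intros)
      have "continuous_on ({0..1} \<times> cbox c1 z) (\<lambda>(x, y). h (x, y))"
        using sub by (auto intro!: continuous_on_subset[OF h])
      from integral_continuous_on_param[OF this] have cH: "continuous_on {0..1} H"
        by (simp add: H_def)
      have "((\<lambda>x. H x * sin (\<mu> * x)) has_integral integral {c1..z} (sine_coeff k h)) {0..1}"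
        using int[OF cH] integral_sine_coeff[OF h, of c1 z k] sub z c1 cd by (simp add: H_def \<mu>_def)
      moreover have "((\<lambda>x. \<Phi> x * sin (\<mu> * x)) has_integral integral {c1..z} (sine_coeff k v)) {0..1}"
        using int[OF c\<Phi>] integral_sine_coeff[OF cv(1), of c1 z k] sub z c1 cd by (simp add: \<Phi>_def \<mu>_def)
      moreover have "((\<lambda>x. Dy rect v (x, t) * sin (\<mu> * x)) has_integral G t) {0..1}" if "t \<in> {-1..1}" for t
        using int[OF continuous_on_rect_x[OF cv(3) that]] by (simp add: G_def sine_coeff_def \<mu>_def)
      note this[OF sub(3)] this[OF sub(4)]
      ultimately have "((\<lambda>x. (H x * sin (\<mu> * x) - \<sigma> * (Dy rect v (x, z) * sin (\<mu> * x) - Dy rect v (x, c1) * sin (\<mu> * x)))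
          + (\<mu> * b)\<^sup>2 * (\<Phi> x * sin (\<mu> * x))) has_integral
          (integral {c1..z} (sine_coeff k h) - \<sigma> * (G z - G c1)) + (\<mu> * b)\<^sup>2 * integral {c1..z} (sine_coeff k v)) {0..1}"
        by (intro has_integral_add has_integral_diff has_integral_mult_right)
      then show ?thesis by (simp add: algebra_simps)
    qed
    have "(integral {c1..z} (sine_coeff k h) - \<sigma> * (G z - G c1)) +
        (\<mu> * b)\<^sup>2 * integral {c1..z} (sine_coeff k v) = 0"
      using has_integral_unique[OF I2 I1] Q0 by simp
    then have "\<sigma> * (\<sigma> * (G z - G c1)) =
        \<sigma> * ((\<mu> * b)\<^sup>2 * integral {c1..z} (sine_coeff k v) + integral {c1..z} (sine_coeff k h))"
      by simp
    then have "G z - G c1 =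
        \<sigma> * ((\<mu> * b)\<^sup>2 * integral {c1..z} (sine_coeff k v) + integral {c1..z} (sine_coeff k h))"
      using \<sigma> by (metis mult.assoc mult_1 power2_eq_square)
    also have "\<dots> = integral {c1..z} F"
    proof -
      have "sine_coeff k g integrable_on {c1..z}" if "continuous_on rect g" for g
        using continuous_on_sine_coeff[OF that, of k] sub(2)
        by (auto intro!: integrable_continuous_real intro: continuous_on_subset)
      from this[OF cv(1)] this[OF h] show ?thesis
        unfolding F_def \<mu>_def by (simp add: integral_add integrable_on_mult_right)
    qed
    finally show ?thesis .
  qed
  have "continuous_on {-1..1} F"
    unfolding F_def by (intro continuous_intros continuous_on_sine_coeff cv h)
  then have "continuous_on {c1..d1} F"
    by (rule continuous_on_subset) (use c1 d1 cd in auto)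
  from integral_has_real_derivative[OF this, of y]
  have "((\<lambda>z. G c1 + integral {c1..z} F) has_real_derivative F y) (at y within {c1..d1})"
    using c1 d1 by (auto intro!: derivative_eq_intros)
  then have "(G has_real_derivative F y) (at y within {c1..d1})"
    by (rule has_field_derivative_transform_within[where d = 1])
      (use main[symmetric] c1 d1 in auto)
  then show ?thesis
    using c1 d1 at_within_interior[of y "{c1..d1}"] by (simp add: G_def F_def interior_atLeastAtMost_real)
qed

section \<open>Completeness of the sine system on the unit interval\<close>

text \<open>A polynomial in cos(pi x) times sin(pi x) is a combination of sines, hence orthogonal to
  \<open>f\<close>. By Stone-Weierstrass, cos(pi x) being injective on [0, 1], such polynomials
  approximate \<open>f\<close> itself uniformly. So the integral of f^2 sin(pi x) is 0, and the
  weight is positive inside. Factoring out the weight is what makes an algebra available, as the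
  span of the sines is not closed under products.\<close>

lemma sine_system_complete:
  fixes f :: "real \<Rightarrow> real"
  assumes f: "continuous_on {0..1} f"
    and zero: "\<And>k. k \<ge> 1 \<Longrightarrow> integral {0..1} (\<lambda>x. f x * sin (pi * real k * x)) = 0"
    and x: "x \<in> {0<..<1}"
  shows "f x = 0"
proof -
  define R where "R = {\<lambda>x. poly p (cos (pi * x)) | p. True}"
  interpret function_ring_on R "{0..1}"
  proof
    show "compact {0..1::real}" by simp
    show "continuous_on {0..1} g" if "g \<in> R" for g
      using that by (auto simp: R_def intro!: continuous_intros)
    show "(\<lambda>x. g x + h x) \<in> R" "(\<lambda>x. g x * h x) \<in> R" if gh: "g \<in> R" "h \<in> R" for g h
    proof -
      obtain p q where pq: "g = (\<lambda>x. poly p (cos (pi * x)))" "h = (\<lambda>x. poly q (cos (pi * x)))"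
        using gh by (auto simp: R_def)
      show "(\<lambda>x. g x + h x) \<in> R" unfolding R_def pq by (auto intro!: exI[of _ "p + q"])
      show "(\<lambda>x. g x * h x) \<in> R" unfolding R_def pq by (auto intro!: exI[of _ "p * q"])
    qed
    show "(\<lambda>_. c) \<in> R" for c unfolding R_def by (auto intro!: exI[of _ "[:c:]"])
    show "\<exists>f\<in>R. f x \<noteq> f y" if "x \<in> {0..1}" "y \<in> {0..1}" "x \<noteq> y" for x y
    proof (rule bexI)
      show "(\<lambda>x. cos (pi * x)) \<in> R" unfolding R_def by (auto intro!: exI[of _ "[:0, 1:]"])
      have "pi * x \<le> pi" "pi * y \<le> pi" using that by auto
      then show "cos (pi * x) \<noteq> cos (pi * y)" using that cos_inj_pi[of "pi * x" "pi * y"] by auto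
    qed
  qed
  have int: "(\<lambda>x. f x * g x) integrable_on {0..1}" if "continuous_on {0..1} g" for g :: "real \<Rightarrow> real"
    using that f by (intro integrable_continuous_real continuous_intros)
  \<comment> \<open>Product-to-sum lowers the power of the cosine at the price of both neighbours of
    \<open>k\<close>, so the claim is made for all \<open>k\<close>; for \<open>k = 0\<close> the
    sine is zero.\<close>
  have pow: "integral {0..1} (\<lambda>x. f x * (cos (pi * x) ^ m * sin (pi * real k * x))) = 0" for m k
  proof (induction m arbitrary: k)
    case 0
    then show ?case using zero[of k] by (cases "k = 0") auto
  next
    case (Suc m)
    show ?case
    proof (cases k)
      case (Suc j)
      have "f x * (cos (pi * x) ^ Suc m * sin (pi * real k * x)) =
          1/2 * (f x * (cos (pi * x) ^ m * sin (pi * real (Suc k) * x))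
          + f x * (cos (pi * x) ^ m * sin (pi * real j * x)))" for x
      proof -
        have "pi * real (Suc k) * x = pi * real k * x + pi * x" "pi * real j * x = pi * real k * x - pi * x"
          using Suc by (simp_all add: algebra_simps)
        then show ?thesis by (simp only: sin_add sin_diff) (simp add: algebra_simps)
      qed
      then have "integral {0..1} (\<lambda>x. f x * (cos (pi * x) ^ Suc m * sin (pi * real k * x))) =
          1/2 * (integral {0..1} (\<lambda>x. f x * (cos (pi * x) ^ m * sin (pi * real (Suc k) * x)))
          + integral {0..1} (\<lambda>x. f x * (cos (pi * x) ^ m * sin (pi * real j * x))))"
        by (simp only: integral_mult_right)
          (subst integral_add; auto intro!: int continuous_intros simp del: of_nat_Suc)
      then show ?thesis using Suc.IH[of "Suc k"] Suc.IH[of j] by (simp del: of_nat_Suc)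
    qed simp
  qed
  have R0: "integral {0..1} (\<lambda>x. f x * (g x * sin (pi * x))) = 0" if "g \<in> R" for g
  proof -
    obtain p where p: "g = (\<lambda>x. poly p (cos (pi * x)))" using \<open>g \<in> R\<close> by (auto simp: R_def)
    have "f x * (g x * sin (pi * x)) =
        (\<Sum>i\<le>degree p. coeff p i * (f x * (cos (pi * x) ^ i * sin (pi * real 1 * x))))" for x
      by (simp add: p poly_altdef sum_distrib_left sum_distrib_right algebra_simps)
    then show ?thesis using pow[of _ 1]
      by (simp del: of_nat_1) (subst integral_sum; auto intro!: int continuous_intros integrable_on_mult_right)
  qed
  define J where "J = integral {0..1} (\<lambda>x. f x * (f x * sin (pi * x)))"
  obtain B where B: "\<And>x. x \<in> {0..1} \<Longrightarrow> \<bar>f x\<bar> \<le> B" "B > 0"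
  proof -
    have "bounded (f ` {0..1})" using compact_continuous_image[OF f] compact_imp_bounded by blast
    then obtain B where "B > 0" "\<forall>x\<in>{0..1}. \<bar>f x\<bar> \<le> B" by (auto simp: bounded_pos)
    then show ?thesis using that[of B] by blast
  qed
  \<comment> \<open>Subtracting the vanishing integral against an approximation \<open>g\<close>
    turns one factor \<open>f\<close> of the integrand into \<open>f - g\<close>.\<close>
  have "\<bar>J\<bar> \<le> e * B" if e: "e > 0" for e
  proof -
    obtain g where g: "g \<in> R" "\<forall>x\<in>{0..1}. \<bar>f x - g x\<bar> < e" using Stone_Weierstrass_basic[OF f e] by blast
    have cg: "continuous_on {0..1} g" using g continuous by auto
    have "J = J - integral {0..1} (\<lambda>x. f x * (g x * sin (pi * x)))" using R0[OF g(1)] by simp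
    also have "\<dots> = integral {0..1} (\<lambda>x. f x * (f x * sin (pi * x)) - f x * (g x * sin (pi * x)))"
      unfolding J_def using f cg by (subst integral_diff) (auto intro!: int continuous_intros)
    also have "norm \<dots> \<le> B * e * (1 - 0)"
    proof (rule integral_bound)
      show "continuous_on {0..1} (\<lambda>x. f x * (f x * sin (pi * x)) - f x * (g x * sin (pi * x)))"
        using f cg by (intro continuous_intros)
      fix t :: real assume t: "t \<in> {0..1}"
      have "\<bar>f t\<bar> * (\<bar>f t - g t\<bar> * \<bar>sin (pi * t)\<bar>) \<le> B * (e * 1)"
        using B(1)[OF t] B(2) g(2) t e by (intro mult_mono) (auto intro: less_imp_le)
      then show "norm (f t * (f t * sin (pi * t)) - f t * (g t * sin (pi * t))) \<le> B * e"
        by (simp add: abs_mult flip: right_diff_distrib left_diff_distrib)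
    qed simp
    finally show ?thesis by (simp add: mult.commute)
  qed
  then have "\<bar>J\<bar> \<le> e" if "e > 0" for e using that B(2) by (metis divide_pos_pos nonzero_eq_divide_eq less_irrefl)
  then have "J = 0" using field_le_epsilon[of "\<bar>J\<bar>" 0] by simp
  moreover have "((\<lambda>x. f x * (f x * sin (pi * x))) has_integral J) (cbox 0 1)"
    unfolding J_def box_real using f by (intro integrable_integral int continuous_intros)
  ultimately have "((\<lambda>x. f x * (f x * sin (pi * x))) has_integral 0) (cbox 0 1)" by simp
  then have "f x * (f x * sin (pi * x)) = 0"
  proof (rule has_integral_0_cbox_imp_0[rotated 2])
    show "continuous_on (cbox 0 1) (\<lambda>x. f x * (f x * sin (pi * x)))"
      unfolding box_real using f by (intro continuous_intros)
    show "0 \<le> f t * (f t * sin (pi * t))" if "t \<in> box 0 1" for t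
      using that by (auto simp: sin_ge_zero mult_nonneg_nonneg simp flip: mult.assoc)
  qed (use x in auto)
  moreover have "sin (pi * x) > 0" using x by (intro sin_gt_zero) auto
  ultimately show ?thesis by simp
qed

subsection \<open>Modes\<close>

text \<open>The \<open>t\<close>-th derivative of \<open>p e\<^bsup>\<mu>y\<^esup> + q e\<^bsup>-\<mu>y\<^esup>\<close> for \<open>\<sigma> = 1\<close> and of \<open>p cos \<mu>y + q sin \<mu>y\<close> for \<open>\<sigma> = -1\<close>.\<close>

definition mode :: "real \<Rightarrow> real \<Rightarrow> real \<Rightarrow> real \<Rightarrow> nat \<Rightarrow> real \<Rightarrow> real" where
  "mode \<sigma> \<mu> p q t y =
    (if \<sigma> = 1 then p * \<mu> ^ t * exp (\<mu> * y) + q * (- \<mu>) ^ t * exp (- (\<mu> * y))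
     else p * \<mu> ^ t * cos (\<mu> * y + pi * real t / 2) + q * \<mu> ^ t * sin (\<mu> * y + pi * real t / 2))"

lemma mode_has_derivative:
  "(mode \<sigma> \<mu> p q t has_real_derivative mode \<sigma> \<mu> p q (Suc t) y) (at y within S)"
proof (cases "\<sigma> = 1")
  case True
  then have "mode \<sigma> \<mu> p q t = (\<lambda>y. p * \<mu> ^ t * exp (\<mu> * y) + q * (- \<mu>) ^ t * exp (- (\<mu> * y)))"
    by (simp add: mode_def[abs_def])
  then show ?thesis
    using True by (auto simp: mode_def intro!: derivative_eq_intros)
next
  case False
  have "\<mu> * y + pi * real (Suc t) / 2 = (\<mu> * y + pi * real t / 2) + pi / 2"
    by (simp add: algebra_simps add_divide_distrib)
  then have "cos (\<mu> * y + pi * real (Suc t) / 2) = - sin (\<mu> * y + pi * real t / 2)"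
    "sin (\<mu> * y + pi * real (Suc t) / 2) = cos (\<mu> * y + pi * real t / 2)"
    by (simp_all only: cos_add[of _ "pi / 2"] sin_add[of _ "pi / 2"] sin_pi_half cos_pi_half)
  moreover have "mode \<sigma> \<mu> p q t = (\<lambda>y. p * \<mu> ^ t * cos (\<mu> * y + pi * real t / 2) +
      q * \<mu> ^ t * sin (\<mu> * y + pi * real t / 2))"
    using False by (simp add: mode_def[abs_def])
  ultimately show ?thesis
    using False by (auto simp: mode_def simp del: of_nat_Suc intro!: derivative_eq_intros)
qed

lemma mode_Suc_Suc:
  assumes "\<sigma> = 1 \<or> \<sigma> = -1"
  shows "mode \<sigma> \<mu> p q (Suc (Suc t)) y = \<sigma> * \<mu>\<^sup>2 * mode \<sigma> \<mu> p q t y"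
proof (cases "\<sigma> = 1")
  case True
  then show ?thesis by (simp add: mode_def algebra_simps power2_eq_square)
next
  case False
  have "\<mu> * y + pi * real (Suc (Suc t)) / 2 = (\<mu> * y + pi * real t / 2) + pi"
    by (simp add: algebra_simps add_divide_distrib)
  then have "cos (\<mu> * y + pi * real (Suc (Suc t)) / 2) = - cos (\<mu> * y + pi * real t / 2)"
    "sin (\<mu> * y + pi * real (Suc (Suc t)) / 2) = - sin (\<mu> * y + pi * real t / 2)"
    by (simp_all only: cos_periodic_pi sin_periodic_pi)
  then show ?thesis
    using False assms by (simp add: mode_def power2_eq_square algebra_simps del: of_nat_Suc)
qed

lemma mode_even:
  assumes "\<sigma> = 1 \<or> \<sigma> = -1"
  shows "mode \<sigma> \<mu> p q (2 * m + i) y = (\<sigma> * \<mu>\<^sup>2) ^ m * mode \<sigma> \<mu> p q i y"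
  by (induction m) (simp_all add: mode_Suc_Suc[OF assms])

lemma mode_lincomb:
  "mode \<sigma> \<mu> (r * p + s * p') (r * q + s * q') t y = r * mode \<sigma> \<mu> p q t y + s * mode \<sigma> \<mu> p' q' t y"
  by (simp add: mode_def algebra_simps)

lemma mode_scale: "mode \<sigma> \<mu> (r * p) (r * q) t y = r * mode \<sigma> \<mu> p q t y"
  by (simp add: mode_def algebra_simps)

lemma mode_eq_0_at_0:
  assumes "\<sigma> = 1 \<or> \<sigma> = -1" "\<mu> \<noteq> 0" "mode \<sigma> \<mu> p q 0 0 = 0" "mode \<sigma> \<mu> p q 1 0 = 0"
  shows "p = 0 \<and> q = 0"
proof (cases "\<sigma> = 1")
  case True
  then have "p + q = 0" "\<mu> * (p - q) = 0" using assms(3,4) by (simp_all add: mode_def algebra_simps)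
  then show ?thesis using assms(2) by simp
next
  case False
  then show ?thesis using assms by (simp add: mode_def)
qed

section \<open>Free and forced oscillator equations\<close>

text \<open>The Wronskian of \<open>V\<close> with each of the two basic modes is constant, since
  both solve the same second-order equation. The mutual Wronskian \<open>w\<close> of the basic
  modes is a nonzero constant, so \<open>V\<close> is recovered by Cramer's rule.\<close>

lemma oscillator_solution:
  assumes \<sigma>: "\<sigma> = 1 \<or> \<sigma> = -1" and "\<mu> \<noteq> 0"
    and V: "\<And>y. y \<in> {c<..<d} \<Longrightarrow> (V has_real_derivative V1 y) (at y)"
    and V1: "\<And>y. y \<in> {c<..<d} \<Longrightarrow> (V1 has_real_derivative \<sigma> * \<mu>\<^sup>2 * V y) (at y)"
  shows "\<exists>p q. \<forall>y\<in>{c<..<d}. V y = mode \<sigma> \<mu> p q 0 y"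
proof -
  \<comment> \<open>This is the Wronskian of exp(\<mu> y) and exp(-\<mu> y), respectively of
    cos(\<mu> y) and sin(\<mu> y).\<close>
  define w where "w = (if \<sigma> = 1 then - 2 * \<mu> else \<mu>)"
  have w: "mode \<sigma> \<mu> 1 0 0 y * mode \<sigma> \<mu> 0 1 1 y - mode \<sigma> \<mu> 1 0 1 y * mode \<sigma> \<mu> 0 1 0 y = w" for y
  proof (cases "\<sigma> = 1")
    case True
    have "exp (\<mu> * y) * exp (- (\<mu> * y)) = 1" by (simp flip: exp_add)
    then show ?thesis using True by (simp add: mode_def w_def algebra_simps)
  next
    case False
    have "\<mu> * (cos (\<mu> * y) * cos (\<mu> * y) + sin (\<mu> * y) * sin (\<mu> * y)) = \<mu>" by simp
    then have "\<mu> * (cos (\<mu> * y) * cos (\<mu> * y)) + \<mu> * (sin (\<mu> * y) * sin (\<mu> * y)) = \<mu>"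
      by (simp only: distrib_left)
    then show ?thesis using False
      by (simp add: mode_def w_def cos_add sin_add algebra_simps power2_eq_square)
  qed
  have w0: "w \<noteq> 0" using \<open>\<mu> \<noteq> 0\<close> by (simp add: w_def)
  have m2: "mode \<sigma> \<mu> p q (Suc (Suc 0)) y = \<sigma> * \<mu>\<^sup>2 * mode \<sigma> \<mu> p q 0 y" for p q y
    by (rule mode_Suc_Suc[OF \<sigma>])
  have const: "\<exists>C. \<forall>y\<in>{c<..<d}. V y * mode \<sigma> \<mu> p q 1 y - V1 y * mode \<sigma> \<mu> p q 0 y = C" for p q
  proof (rule has_field_derivative_zero_constant)
    fix y assume y: "y \<in> {c<..<d}"
    have "((\<lambda>y. V y * mode \<sigma> \<mu> p q 1 y - V1 y * mode \<sigma> \<mu> p q 0 y) has_real_derivative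
        (V1 y * mode \<sigma> \<mu> p q 1 y + mode \<sigma> \<mu> p q (Suc 1) y * V y) -
        (\<sigma> * \<mu>\<^sup>2 * V y * mode \<sigma> \<mu> p q 0 y + mode \<sigma> \<mu> p q (Suc 0) y * V1 y)) (at y)"
      by (intro DERIV_diff DERIV_mult V V1 y mode_has_derivative)
    then have "((\<lambda>y. V y * mode \<sigma> \<mu> p q 1 y - V1 y * mode \<sigma> \<mu> p q 0 y) has_real_derivative 0) (at y)"
      by (simp add: m2 algebra_simps)
    then show "((\<lambda>y. V y * mode \<sigma> \<mu> p q 1 y - V1 y * mode \<sigma> \<mu> p q 0 y) has_real_derivative 0)
        (at y within {c<..<d})"
      by (rule has_field_derivative_at_within)
  qed simp
  obtain P where P: "\<And>y. y \<in> {c<..<d} \<Longrightarrow> V y * mode \<sigma> \<mu> 0 1 1 y - V1 y * mode \<sigma> \<mu> 0 1 0 y = P"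
    using const[of 0 1] by blast
  obtain Q where Q: "\<And>y. y \<in> {c<..<d} \<Longrightarrow> V y * mode \<sigma> \<mu> 1 0 1 y - V1 y * mode \<sigma> \<mu> 1 0 0 y = Q"
    using const[of 1 0] by blast
  have "V y = mode \<sigma> \<mu> (P / w) (- Q / w) 0 y" if y: "y \<in> {c<..<d}" for y
  proof -
    have "w * V y = mode \<sigma> \<mu> 1 0 0 y * P - mode \<sigma> \<mu> 0 1 0 y * Q"
      unfolding P[OF y, symmetric] Q[OF y, symmetric] w[of y, symmetric] by (simp add: algebra_simps)
    also have "mode \<sigma> \<mu> 1 0 0 y * P - mode \<sigma> \<mu> 0 1 0 y * Q =
        w * (P / w * mode \<sigma> \<mu> 1 0 0 y + - Q / w * mode \<sigma> \<mu> 0 1 0 y)"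
      using w0 by (simp add: field_simps)
    also have "\<dots> = w * mode \<sigma> \<mu> (P / w) (- Q / w) 0 y"
      using mode_lincomb[of \<sigma> \<mu> "P / w" 1 "- Q / w" 0 0 1 0 y] by simp
    finally show ?thesis using w0 by simp
  qed
  then show ?thesis by blast
qed

definition mode_sum :: "'i set \<Rightarrow> ('i \<Rightarrow> real) \<Rightarrow> real \<Rightarrow> ('i \<Rightarrow> real) \<Rightarrow> ('i \<Rightarrow> real) \<Rightarrow> nat \<Rightarrow> real \<Rightarrow> real" where
  "mode_sum I \<mu> \<sigma> p q t y = (\<Sum>i\<in>I. mode \<sigma> (\<mu> i) (p i) (q i) t y)"

lemma mode_sum_has_derivative:
  "(mode_sum I \<mu> \<sigma> p q t has_real_derivative mode_sum I \<mu> \<sigma> p q (Suc t) y) (at y within S)"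
  unfolding mode_sum_def[abs_def] by (rule DERIV_sum) (rule mode_has_derivative)

lemma continuous_on_mode_sum: "continuous_on S (mode_sum I \<mu> \<sigma> p q t)"
  by (rule DERIV_continuous_on) (rule mode_sum_has_derivative)

text \<open>No forcing frequency is resonant, so each mode in \<open>H\<close> has a particular
  response of the same shape, scaled by \<open>r i\<close>, and no terms such as y exp(\<mu> y)
  occur. The remainder solves the free equation with the frequency of \<open>j\<close>.\<close>

lemma forced_oscillator_solution:
  assumes \<sigma>: "\<sigma> = 1 \<or> \<sigma> = -1" and I: "finite I" "j \<notin> I"
    and \<mu>: "\<mu> j \<noteq> 0" "\<And>i. i \<in> I \<Longrightarrow> (\<mu> i)\<^sup>2 \<noteq> (\<mu> j)\<^sup>2"
    and V: "\<And>y. y \<in> {c<..<d} \<Longrightarrow> (V has_real_derivative V1 y) (at y)"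
    and V1: "\<And>y. y \<in> {c<..<d} \<Longrightarrow> (V1 has_real_derivative \<sigma> * ((\<mu> j)\<^sup>2 * V y + H y)) (at y)"
    and H: "\<And>y. y \<in> {c<..<d} \<Longrightarrow> H y = mode_sum I \<mu> \<sigma> p q 0 y"
  shows "\<exists>p q. \<forall>y\<in>{c<..<d}. V y = mode_sum (insert j I) \<mu> \<sigma> p q 0 y"
proof -
  define r where "r i = 1 / ((\<mu> i)\<^sup>2 - (\<mu> j)\<^sup>2)" for i
  define S where "S = mode_sum I \<mu> \<sigma> (\<lambda>i. r i * p i) (\<lambda>i. r i * q i)"
  have S': "(S t has_real_derivative S (Suc t) y) (at y)" for t y
    unfolding S_def by (rule mode_sum_has_derivative)
  have "\<exists>p q. \<forall>y\<in>{c<..<d}. V y - S 0 y = mode \<sigma> (\<mu> j) p q 0 y"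
  proof (rule oscillator_solution[OF \<sigma> \<mu>(1)])
    fix y assume y: "y \<in> {c<..<d}"
    show "((\<lambda>y. V y - S 0 y) has_real_derivative V1 y - S (Suc 0) y) (at y)"
      by (intro DERIV_diff V y S')
    have D: "((\<lambda>y. V1 y - S (Suc 0) y) has_real_derivative
        \<sigma> * ((\<mu> j)\<^sup>2 * V y + H y) - S (Suc (Suc 0)) y) (at y)"
      by (intro DERIV_diff V1 y S')
    have "\<sigma> * ((\<mu> j)\<^sup>2 * S 0 y + H y) = S (Suc (Suc 0)) y"
      unfolding H[OF y] S_def mode_sum_def sum_distrib_left mode_scale mode_Suc_Suc[OF \<sigma>]
        sum.distrib[symmetric]
      by (rule sum.cong) (use \<mu>(2) in \<open>auto simp: r_def field_simps\<close>)
    then have eq: "\<sigma> * ((\<mu> j)\<^sup>2 * V y + H y) - S (Suc (Suc 0)) y = \<sigma> * (\<mu> j)\<^sup>2 * (V y - S 0 y)"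
      by (simp add: algebra_simps)
    show "((\<lambda>y. V1 y - S (Suc 0) y) has_real_derivative \<sigma> * (\<mu> j)\<^sup>2 * (V y - S 0 y)) (at y)"
      using D unfolding eq .
  qed
  then obtain p' q' where *: "\<And>y. y \<in> {c<..<d} \<Longrightarrow> V y - S 0 y = mode \<sigma> (\<mu> j) p' q' 0 y"
    by blast
  have "V y = mode_sum (insert j I) \<mu> \<sigma> ((\<lambda>i. r i * p i)(j := p')) ((\<lambda>i. r i * q i)(j := q')) 0 y"
    if y: "y \<in> {c<..<d}" for y
  proof -
    have "S 0 y = (\<Sum>i\<in>I. mode \<sigma> (\<mu> i) (((\<lambda>i. r i * p i)(j := p')) i) (((\<lambda>i. r i * q i)(j := q')) i) 0 y)"
      unfolding S_def mode_sum_def by (rule sum.cong) (use I in auto)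
    then show ?thesis using *[OF y] I by (simp add: mode_sum_def algebra_simps)
  qed
  then show ?thesis by blast
qed

section \<open>Linear independence of modes\<close>

text \<open>Lagrange interpolation in place of a Vandermonde determinant: vanishing moments kill the
  sum of \<open>x i * poly P (b i)\<close> for every polynomial, in particular for the
  \<open>P\<close> whose roots are the nodes other than \<open>b j\<close>.\<close>

lemma power_sums_eq_0_imp_eq_0:
  fixes x b :: "'i \<Rightarrow> 'a::field"
  assumes "finite I" "inj_on b I" and zero: "\<And>m. (\<Sum>i\<in>I. x i * b i ^ m) = 0" and j: "j \<in> I"
  shows "x j = 0"
proof -
  define P where "P = (\<Prod>i\<in>I - {j}. [:- b i, 1:])"
  have "(\<Sum>i\<in>I. x i * poly P (b i)) = (\<Sum>i\<in>I. \<Sum>m\<le>degree P. coeff P m * (x i * b i ^ m))"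
    by (simp add: poly_altdef sum_distrib_left algebra_simps)
  also have "\<dots> = (\<Sum>m\<le>degree P. coeff P m * (\<Sum>i\<in>I. x i * b i ^ m))"
    by (subst sum.swap) (simp add: sum_distrib_left)
  also have "\<dots> = 0" by (simp add: zero)
  also have "(\<Sum>i\<in>I. x i * poly P (b i)) = x j * poly P (b j) + (\<Sum>i\<in>I - {j}. x i * poly P (b i))"
    by (rule sum.remove) (use assms in auto)
  also have "(\<Sum>i\<in>I - {j}. x i * poly P (b i)) = 0"
    using assms(1) by (intro sum.neutral) (auto simp: P_def poly_prod)
  finally have "x j * poly P (b j) = 0" by simp
  moreover have "poly P (b j) \<noteq> 0"
    using assms(1,2) j by (auto simp: P_def poly_prod inj_on_def)
  ultimately show ?thesis by simp
qed

text \<open>Derivatives at 0 of orders of one parity are power sums in the nodes \<sigma> (\<mu>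
  i)^2, which are distinct because the frequencies are distinct and positive. So each single mode
  has value and slope 0 at 0.\<close>

lemma mode_sum_eq_0_imp_eq_0:
  assumes \<sigma>: "\<sigma> = 1 \<or> \<sigma> = -1" and I: "finite I"
    and \<mu>: "\<And>i. i \<in> I \<Longrightarrow> \<mu> i > 0" "inj_on \<mu> I"
    and zero: "\<And>t. mode_sum I \<mu> \<sigma> p q t 0 = 0" and j: "j \<in> I"
  shows "p j = 0 \<and> q j = 0"
proof -
  have inj: "inj_on (\<lambda>i. \<sigma> * (\<mu> i)\<^sup>2) I"
  proof (rule inj_onI)
    fix i i' assume i: "i \<in> I" "i' \<in> I" and eq: "\<sigma> * (\<mu> i)\<^sup>2 = \<sigma> * (\<mu> i')\<^sup>2"
    then have "(\<mu> i)\<^sup>2 = (\<mu> i')\<^sup>2" using \<sigma> by auto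
    then have "\<mu> i = \<mu> i'" using \<mu>(1)[OF i(1)] \<mu>(1)[OF i(2)] by (simp add: power2_eq_iff)
    then show "i = i'" using \<mu>(2) i by (simp add: inj_on_eq_iff)
  qed
  have "mode \<sigma> (\<mu> j) (p j) (q j) e 0 = 0" for e
  proof (rule power_sums_eq_0_imp_eq_0[OF I inj _ j])
    fix m
    show "(\<Sum>i\<in>I. mode \<sigma> (\<mu> i) (p i) (q i) e 0 * (\<sigma> * (\<mu> i)\<^sup>2) ^ m) = 0"
      using zero[of "2 * m + e"]
      unfolding mode_sum_def mult.commute[of "mode _ _ _ _ _ _"] mode_even[OF \<sigma>, symmetric] .
  qed
  then show ?thesis using mode_eq_0_at_0[OF \<sigma>, of "\<mu> j" "p j" "q j"] \<mu>(1)[OF j] by simp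
qed

subsection \<open>The kernel of the coefficient matrix\<close>

text \<open>Up to the nonzero factors \<open>(\<pi>k)\<^sup>t\<close> the rows of the system are the conditions on the modes with
  frequencies \<open>\<pi> k a\<^sub>s\<close> at \<open>y = 1\<close>, \<open>y = -1\<close> and \<open>y = 0\<close>.\<close>

definition kernel_modes :: "nat \<Rightarrow> (nat \<Rightarrow> real) \<Rightarrow> (nat \<Rightarrow> real) \<Rightarrow> (nat \<Rightarrow> real) \<Rightarrow>
    (nat \<Rightarrow> real) \<Rightarrow> (nat \<Rightarrow> real) \<Rightarrow> bool" where
  "kernel_modes n \<mu> p q p' q' \<longleftrightarrow>
    (\<forall>m<n. mode_sum {1..n} \<mu> 1 p q (2 * m) 1 = 0) \<and>
    (\<forall>m<n. mode_sum {1..n} \<mu> (-1) p' q' (2 * m) (-1) = 0) \<and>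
    (\<forall>t<2*n. mode_sum {1..n} \<mu> 1 p q t 0 = mode_sum {1..n} \<mu> (-1) p' q' t 0)"

lemma
  fixes a c d :: "nat \<Rightarrow> real" and n k :: nat
  defines "v \<equiv> Matrix.vec (4 * n) (\<lambda>j. if j < 2 * n then c (j + 1) else d (j - 2 * n + 1))"
    and "\<mu> \<equiv> (\<lambda>s. pi * real k * a s)"
    and "p \<equiv> (\<lambda>s. c (2 * s - 1))" and "q \<equiv> (\<lambda>s. c (2 * s))"
    and "p' \<equiv> (\<lambda>s. d (2 * s - 1))" and "q' \<equiv> (\<lambda>s. d (2 * s))"
  shows mode_sum_at_1: "m < n \<Longrightarrow> mode_sum {1..n} \<mu> 1 p q (2 * m) 1 =
      (pi * real k) ^ (2 * m) * Matrix.vec_index (mult_mat_vec (coeff_matrix n a k) v) m"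
    and mode_sum_at_minus_1: "m < n \<Longrightarrow> mode_sum {1..n} \<mu> (-1) p' q' (2 * m) (-1) =
      (-1) ^ m * (pi * real k) ^ (2 * m) * Matrix.vec_index (mult_mat_vec (coeff_matrix n a k) v) (n + m)"
    and mode_sum_at_0: "t < 2 * n \<Longrightarrow>
      mode_sum {1..n} \<mu> 1 p q t 0 - mode_sum {1..n} \<mu> (-1) p' q' t 0 =
      (pi * real k) ^ t * Matrix.vec_index (mult_mat_vec (coeff_matrix n a k) v) (2 * n + t)"
proof -
  assume m: "m < n"
  show "mode_sum {1..n} \<mu> 1 p q (2 * m) 1 =
      (pi * real k) ^ (2 * m) * Matrix.vec_index (mult_mat_vec (coeff_matrix n a k) v) m"
    unfolding v_def coeff_matrix_mult(1)[OF m] mode_sum_def sum_distrib_left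
    by (rule sum.cong) (simp_all add: mode_def \<mu>_def p_def q_def power_mult_distrib algebra_simps)
  \<comment> \<open>The phase at y = -1 is the origin of the sign (-1)^m on the right-hand side of
    the system, and the oddness of the sine that of the minus sign in its second block.\<close>
  have cs: "cos (x * - 1 + pi * real (2 * m) / 2) = (-1) ^ m * cos x"
    "sin (x * - 1 + pi * real (2 * m) / 2) = - ((-1) ^ m * sin x)" for x
    using cos_npi2[of m] sin_npi2[of m] by (simp_all add: cos_diff sin_diff)
  show "mode_sum {1..n} \<mu> (-1) p' q' (2 * m) (-1) =
      (-1) ^ m * (pi * real k) ^ (2 * m) * Matrix.vec_index (mult_mat_vec (coeff_matrix n a k) v) (n + m)"
    unfolding v_def coeff_matrix_mult(2)[OF m] mode_sum_def sum_distrib_left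
    by (rule sum.cong) (simp_all only: mode_def cs if_False, simp_all add: \<mu>_def p'_def q'_def power_mult_distrib algebra_simps)
next
  assume t: "t < 2 * n"
  have pw: "(- (pi * real k * x)) ^ t = (pi * real k) ^ t * (- x) ^ t" for x :: real
    by (simp flip: power_mult_distrib)
  show "mode_sum {1..n} \<mu> 1 p q t 0 - mode_sum {1..n} \<mu> (-1) p' q' t 0 =
      (pi * real k) ^ t * Matrix.vec_index (mult_mat_vec (coeff_matrix n a k) v) (2 * n + t)"
    unfolding v_def coeff_matrix_mult(3)[OF t] mode_sum_def right_diff_distrib sum_distrib_left
    by (intro arg_cong2[where f = "(-)"] sum.cong)
      (simp_all add: mode_def \<mu>_def p_def q_def p'_def q'_def pw, simp_all add: power_mult_distrib algebra_simps)
qed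

lemma mult_coeff_matrix_eq_0_iff:
  fixes a c d :: "nat \<Rightarrow> real" and n k :: nat
  defines "v \<equiv> Matrix.vec (4 * n) (\<lambda>j. if j < 2 * n then c (j + 1) else d (j - 2 * n + 1))"
  assumes "k \<ge> 1"
  shows "mult_mat_vec (coeff_matrix n a k) v = 0\<^sub>v (4 * n) \<longleftrightarrow>
    kernel_modes n (\<lambda>s. pi * real k * a s) (\<lambda>s. c (2 * s - 1)) (\<lambda>s. c (2 * s))
      (\<lambda>s. d (2 * s - 1)) (\<lambda>s. d (2 * s))"
proof -
  define f where "f = (\<lambda>i. Matrix.vec_index (mult_mat_vec (coeff_matrix n a k) v) i)"
  have nz: "pi * real k \<noteq> 0" using assms by simp
  have "mult_mat_vec (coeff_matrix n a k) v = 0\<^sub>v (4 * n) \<longleftrightarrow> (\<forall>i<4 * n. f i = 0)"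
  proof safe
    fix i assume "mult_mat_vec (coeff_matrix n a k) v = 0\<^sub>v (4 * n)" "i < 4 * n"
    then show "f i = 0" by (simp add: f_def)
  next
    assume "\<forall>i<4 * n. f i = 0"
    then show "mult_mat_vec (coeff_matrix n a k) v = 0\<^sub>v (4 * n)"
      by (intro eq_vecI) (auto simp: f_def coeff_matrix_def)
  qed
  also have "\<dots> \<longleftrightarrow> (\<forall>m<n. f m = 0) \<and> (\<forall>m<n. f (n + m) = 0) \<and> (\<forall>t<2 * n. f (2 * n + t) = 0)"
  proof safe
    fix i assume *: "\<forall>m<n. f m = 0" "\<forall>m<n. f (n + m) = 0" "\<forall>t<2 * n. f (2 * n + t) = 0" "i < 4 * n"
    consider "i < n" | "n \<le> i" "i - n < n" | "2 * n \<le> i" "i - 2 * n < 2 * n" using *(4) by linarith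
    then show "f i = 0" using *(1-3) by cases (metis le_add_diff_inverse)+
  qed auto
  also have "\<dots> \<longleftrightarrow> kernel_modes n (\<lambda>s. pi * real k * a s) (\<lambda>s. c (2 * s - 1)) (\<lambda>s. c (2 * s))
      (\<lambda>s. d (2 * s - 1)) (\<lambda>s. d (2 * s))"
  proof -
    have "mode_sum {1..n} (\<lambda>s. pi * real k * a s) 1 (\<lambda>s. c (2 * s - 1)) (\<lambda>s. c (2 * s)) (2 * m) 1 = 0
        \<longleftrightarrow> f m = 0" if "m < n" for m
      using nz mode_sum_at_1[OF that, of k a c d] by (simp add: f_def v_def)
    moreover have "mode_sum {1..n} (\<lambda>s. pi * real k * a s) (-1) (\<lambda>s. d (2 * s - 1)) (\<lambda>s. d (2 * s)) (2 * m) (-1) = 0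
        \<longleftrightarrow> f (n + m) = 0" if "m < n" for m
      using nz mode_sum_at_minus_1[OF that, of k a d c] by (simp add: f_def v_def)
    moreover have "mode_sum {1..n} (\<lambda>s. pi * real k * a s) 1 (\<lambda>s. c (2 * s - 1)) (\<lambda>s. c (2 * s)) t 0 =
        mode_sum {1..n} (\<lambda>s. pi * real k * a s) (-1) (\<lambda>s. d (2 * s - 1)) (\<lambda>s. d (2 * s)) t 0
        \<longleftrightarrow> f (2 * n + t) = 0" if "t < 2 * n" for t
      using nz mode_sum_at_0[OF that, of k a c d]
      by (subst right_minus_eq[symmetric]) (simp add: f_def v_def del: right_minus_eq)
    ultimately show ?thesis by (simp add: kernel_modes_def)
  qed
  finally show ?thesis .
qed

text \<open>A square matrix over a field is singular iff it kills a nonzero vector. The coefficient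
  functions enter that vector only through their values on \<open>{1..n}\<close>, so nontriviality
  is asked for there.\<close>

lemma Delta_eq_0_iff:
  assumes "k \<ge> 1"
  shows "Delta n a k = 0 \<longleftrightarrow> (\<exists>p q p' q'. kernel_modes n (\<lambda>s. pi * real k * a s) p q p' q' \<and>
    (\<exists>s\<in>{1..n}. p s \<noteq> 0 \<or> q s \<noteq> 0 \<or> p' s \<noteq> 0 \<or> q' s \<noteq> 0))"
    (is "_ \<longleftrightarrow> (\<exists>p q p' q'. ?K p q p' q' \<and> ?N p q p' q')")
proof -
  define vv where "vv = (\<lambda>c d. Matrix.vec (4 * n) (\<lambda>j. if j < 2 * n then c (j + 1) else d (j - 2 * n + 1 :: nat)) :: real Matrix.vec)"
  have "coeff_matrix n a k \<in> carrier_mat (4 * n) (4 * n)" by (simp add: coeff_matrix_def)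
  note det = det_0_iff_vec_prod_zero_field[OF this, folded Delta_def]
  have ker: "mult_mat_vec (coeff_matrix n a k) (vv c d) = 0\<^sub>v (4 * n) \<longleftrightarrow>
      ?K (\<lambda>s. c (2 * s - 1)) (\<lambda>s. c (2 * s)) (\<lambda>s. d (2 * s - 1)) (\<lambda>s. d (2 * s))" for c d
    unfolding vv_def by (rule mult_coeff_matrix_eq_0_iff[OF assms])
  show ?thesis
  proof
    assume "Delta n a k = 0"
    then obtain v where v: "v \<in> carrier_vec (4 * n)" "v \<noteq> 0\<^sub>v (4 * n)"
      "mult_mat_vec (coeff_matrix n a k) v = 0\<^sub>v (4 * n)" using det by auto
    \<comment> \<open>The unknowns are numbered from 1, the entries of the vector from 0.\<close>
    define c where "c = (\<lambda>j. Matrix.vec_index v (j - 1))"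
    define d where "d = (\<lambda>j. Matrix.vec_index v (2 * n + j - 1))"
    have vcd: "v = vv c d" using v(1) by (auto simp: vv_def c_def d_def intro!: eq_vecI)
    have "?N (\<lambda>s. c (2 * s - 1)) (\<lambda>s. c (2 * s)) (\<lambda>s. d (2 * s - 1)) (\<lambda>s. d (2 * s))"
    proof (rule ccontr)
      assume N: "\<not> ?thesis"
      have *: "c j = 0 \<and> d j = 0" if "1 \<le> j" "j \<le> 2 * n" for j
      proof (cases "even j")
        case True
        then obtain s where "j = 2 * s" by (rule evenE)
        then show ?thesis using N that by auto
      next
        case False
        then obtain s where "j = 2 * s + 1" by (rule oddE)
        then have "j = 2 * Suc s - 1" "Suc s \<in> {1..n}" using that by auto
        then show ?thesis using N by blast
      qed
      have "v = 0\<^sub>v (4 * n)" unfolding vcd by (rule eq_vecI) (auto simp: vv_def *)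
      then show False using v(2) by simp
    qed
    then show "\<exists>p q p' q'. ?K p q p' q' \<and> ?N p q p' q'" using ker v(3) vcd by blast
  next
    assume "\<exists>p q p' q'. ?K p q p' q' \<and> ?N p q p' q'"
    then obtain p q p' q' where K: "?K p q p' q'" and N: "?N p q p' q'" by blast
    \<comment> \<open>Interleaves two coefficient families into one numbered from 1: odd positions
      carry the first, even ones the second.\<close>
    define w where "w = (\<lambda>p q (j::nat). if odd j then p ((j + 1) div 2) else q (j div 2) :: real)"
    have w: "w p q (2 * s - 1) = p s" "w p q (2 * s) = q s" if "s \<in> {1..n}" for p q s
      using that by (cases s; simp add: w_def)+
    have "kernel_modes n (\<lambda>s. pi * real k * a s) (\<lambda>s. w p q (2 * s - 1)) (\<lambda>s. w p q (2 * s))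
        (\<lambda>s. w p' q' (2 * s - 1)) (\<lambda>s. w p' q' (2 * s))"
      using K unfolding kernel_modes_def mode_sum_def by (simp only: w cong: sum.cong)
    then have "mult_mat_vec (coeff_matrix n a k) (vv (w p q) (w p' q')) = 0\<^sub>v (4 * n)"
      using ker by blast
    moreover have "vv (w p q) (w p' q') \<noteq> 0\<^sub>v (4 * n)"
    proof
      assume zero: "vv (w p q) (w p' q') = 0\<^sub>v (4 * n)"
      have "w p q (j + 1) = 0 \<and> w p' q' (j + 1) = 0" if "j < 2 * n" for j
      proof -
        have "Matrix.vec_index (vv (w p q) (w p' q')) j = 0"
          "Matrix.vec_index (vv (w p q) (w p' q')) (2 * n + j) = 0"
          unfolding zero using that by auto
        then show ?thesis using that by (simp add: vv_def)
      qed
      then have *: "w p q j = 0 \<and> w p' q' j = 0" if "j \<in> {1..2 * n}" for j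
        using that by (cases j) auto
      obtain s where s: "s \<in> {1..n}" "p s \<noteq> 0 \<or> q s \<noteq> 0 \<or> p' s \<noteq> 0 \<or> q' s \<noteq> 0" using N by blast
      then have "2 * s - 1 \<in> {1..2 * n}" "2 * s \<in> {1..2 * n}" by auto
      from *[OF this(1)] *[OF this(2)] show False using s w by auto
    qed
    moreover have "vv (w p q) (w p' q') \<in> carrier_vec (4 * n)" by (simp add: vv_def)
    ultimately show "Delta n a k = 0" using det by blast
  qed
qed

subsection \<open>The differential operator\<close>

lemma closure_Omega: "closure Omega = rect"
proof -
  have "Omega = {0<..<1} \<times> {-1<..<1}" by (auto simp: Omega_def)
  then have "closure Omega = closure {0<..<1} \<times> closure {-1<..<1}" using closure_Times by metis
  then show ?thesis by simp
qed

lemma Omega_plus_Un_minus: "Omega_plus \<union> Omega_minus = {0<..<1} \<times> ({-1<..<0} \<union> {0<..<1})"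
  by (auto simp: Omega_plus_def Omega_minus_def Omega_def)

lemma open_Omega_plus_Un_minus: "open (Omega_plus \<union> Omega_minus)"
  unfolding Omega_plus_Un_minus by (intro open_Times open_Un) auto

text \<open>On either half the sign of \<open>y\<close> is a constant \<open>\<sigma>\<close>, and derivatives relative to a larger set agree.\<close>

lemma foldr_L_factor_eq_wave_factor:
  assumes "open W" "W \<subseteq> S" "W \<subseteq> T" "\<And>x y. (x, y) \<in> W \<Longrightarrow> sgn y = \<sigma>" "p \<in> W"
  shows "foldr (\<lambda>j. L_factor S (a j)) js u p = foldr (\<lambda>j. wave_factor T \<sigma> (a j)) js u p"
  using assms(5)
proof (induction js arbitrary: p)
  case (Cons j js)
  obtain x y where p: "p = (x, y)" by force
  have "L_factor S (a j) (foldr (\<lambda>j. L_factor S (a j)) js u) p =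
      wave_factor S \<sigma> (a j) (foldr (\<lambda>j. L_factor S (a j)) js u) p"
    using assms(4) Cons.prems by (simp add: p L_factor_def wave_factor_def)
  also have "\<dots> = wave_factor T \<sigma> (a j) (foldr (\<lambda>j. wave_factor T \<sigma> (a j)) js u) p"
    by (rule wave_factor_local[OF assms(1-3) Cons.IH Cons.prems])
  finally show ?case by simp
qed simp

lemma wave_factor_lincomb:
  assumes S: "perfect_sections S" and "C_k_on (Suc (Suc k)) S u" "C_k_on (Suc (Suc k)) S v" "p \<in> S"
  shows "wave_factor S \<sigma> b (\<lambda>p. \<alpha> * u p + \<beta> * v p) p = \<alpha> * wave_factor S \<sigma> b u p + \<beta> * wave_factor S \<sigma> b v p"
proof -
  have "C_k_on 2 S u" "C_k_on 2 S v"
    using assms(2,3) by (auto intro!: C_k_on_mono[of "Suc (Suc k)"] simp del: C_k_on.simps)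
  from Dx_funpow_lincomb[OF S this order_refl assms(4)] Dy_funpow_lincomb[OF S this order_refl assms(4)]
  show ?thesis by (simp add: wave_factor_def numeral_2_eq_2 algebra_simps)
qed

lemma C_k_on_foldr_wave_factor:
  assumes S: "perfect_sections S" and "C_k_on (k + 2 * length js) S u"
  shows "C_k_on k S (foldr (\<lambda>j. wave_factor S \<sigma> (a j)) js u)"
  using assms(2)
proof (induction js arbitrary: k)
  case (Cons j js)
  then have "C_k_on (Suc (Suc k)) S (foldr (\<lambda>j. wave_factor S \<sigma> (a j)) js u)"
    by (intro Cons.IH) simp
  then show ?case using C_k_on_wave_factor[OF S] by simp
qed simp

lemma foldr_wave_factor_lincomb:
  assumes S: "perfect_sections S" and "C_k_on (2 * length js) S u" "C_k_on (2 * length js) S v" "p \<in> S"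
  shows "foldr (\<lambda>j. wave_factor S \<sigma> (a j)) js (\<lambda>p. \<alpha> * u p + \<beta> * v p) p =
    \<alpha> * foldr (\<lambda>j. wave_factor S \<sigma> (a j)) js u p + \<beta> * foldr (\<lambda>j. wave_factor S \<sigma> (a j)) js v p"
  using assms(2-4)
proof (induction js arbitrary: p)
  case (Cons j js)
  define f where "f = foldr (\<lambda>j. wave_factor S \<sigma> (a j)) js"
  have reg: "C_k_on (Suc (Suc 0)) S (f u)" "C_k_on (Suc (Suc 0)) S (f v)"
    unfolding f_def using Cons.prems by (auto intro!: C_k_on_foldr_wave_factor[OF S] simp del: C_k_on.simps)
  have "f (\<lambda>p. \<alpha> * u p + \<beta> * v p) q = \<alpha> * f u q + \<beta> * f v q" if "q \<in> S" for q
    unfolding f_def using that Cons.prems by (intro Cons.IH) (auto intro: C_k_on_mono simp del: C_k_on.simps)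
  then have "wave_factor S \<sigma> (a j) (f (\<lambda>p. \<alpha> * u p + \<beta> * v p)) p =
      wave_factor S \<sigma> (a j) (\<lambda>p. \<alpha> * f u p + \<beta> * f v p) p"
    unfolding wave_factor_def using Cons.prems(3)
    by (intro arg_cong2[where f = "(+)"] arg_cong2[where f = "(*)"] refl Dx_cong Dy_cong) auto
  also have "\<dots> = \<alpha> * wave_factor S \<sigma> (a j) (f u) p + \<beta> * wave_factor S \<sigma> (a j) (f v) p"
    by (rule wave_factor_lincomb[OF S reg Cons.prems(3)])
  finally show ?case by (simp add: f_def)
qed simp

text \<open>Indexing by the value of \<open>sgn y\<close> lets one argument serve both
  halves.\<close>

definition half :: "real \<Rightarrow> (real \<times> real) set" where
  "half \<sigma> = {0<..<1} \<times> (if \<sigma> = 1 then {0<..<1} else {-1<..<0})"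

lemma half:
  assumes "\<sigma> = 1 \<or> \<sigma> = -1"
  shows "open (half \<sigma>)" "half \<sigma> \<subseteq> Omega_plus \<union> Omega_minus" "half \<sigma> \<subseteq> rect"
    "(x, y) \<in> half \<sigma> \<Longrightarrow> sgn y = \<sigma>"
  using assms unfolding Omega_plus_Un_minus half_def
  by (auto intro!: open_Times split: if_splits)

lemma half_cases:
  assumes "p \<in> Omega_plus \<union> Omega_minus"
  obtains \<sigma> where "\<sigma> = 1 \<or> \<sigma> = -1" "p \<in> half \<sigma>"
  using assms that[of 1] that[of "-1"] unfolding Omega_plus_Un_minus half_def by auto

lemma L_op_eq_wave_factor:
  assumes "\<sigma> = 1 \<or> \<sigma> = -1" "half \<sigma> \<subseteq> T" "p \<in> half \<sigma>"
  shows "L_op n a u p = foldr (\<lambda>j. wave_factor T \<sigma> (a j)) [1..<Suc n] u p"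
  unfolding L_op_def
  by (rule foldr_L_factor_eq_wave_factor[OF half(1,2)[OF assms(1)] assms(2) half(4)[OF assms(1)] assms(3)])

text \<open>Serves both directions: weights 1 and -1 give the difference of two solutions, weights 1
  and 1 add a homogeneous solution. Linearity of iterated derivatives is available only within the
  smoothness class, so orders are tracked: at most \<open>2 * n - 2\<close> in the boundary
  conditions on the closed rectangle, \<open>2 * n\<close> in the equation on an open half.\<close>

lemma dirichlet_solution_lincomb:
  assumes "n \<ge> 1" and u: "dirichlet_solution n a \<phi> \<psi> u" and v: "dirichlet_solution n a \<phi>' \<psi>' v"
  shows "dirichlet_solution n a (\<lambda>s x. \<alpha> * \<phi> s x + \<beta> * \<phi>' s x) (\<lambda>s x. \<alpha> * \<psi> s x + \<beta> * \<psi>' s x)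
    (\<lambda>p. \<alpha> * u p + \<beta> * v p)"
proof -
  have C: "C_k_on (2 * n - 1) rect u" "C_k_on (2 * n - 1) rect v"
    "C_k_on (2 * n) (Omega_plus \<union> Omega_minus) u" "C_k_on (2 * n) (Omega_plus \<union> Omega_minus) v"
    using u v by (auto simp: dirichlet_solution_def closure_Omega)
  have L: "L_op n a (\<lambda>p. \<alpha> * u p + \<beta> * v p) p = 0" if p: "p \<in> Omega_plus \<union> Omega_minus" for p
  proof -
    obtain \<sigma> where \<sigma>: "\<sigma> = 1 \<or> \<sigma> = -1" "p \<in> half \<sigma>" using half_cases[OF p] .
    have "C_k_on (2 * length [1..<Suc n]) (half \<sigma>) u" "C_k_on (2 * length [1..<Suc n]) (half \<sigma>) v"
      using C_k_on_open_subset[OF half(1,2)[OF \<sigma>(1)] C(3)] C_k_on_open_subset[OF half(1,2)[OF \<sigma>(1)] C(4)]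
      by (simp_all only: length_upt diff_Suc_1)
    from foldr_wave_factor_lincomb[OF perfect_sections_open[OF half(1)[OF \<sigma>(1)]] this \<sigma>(2)]
    have "L_op n a (\<lambda>p. \<alpha> * u p + \<beta> * v p) p = \<alpha> * L_op n a u p + \<beta> * L_op n a v p"
      unfolding L_op_eq_wave_factor[OF \<sigma>(1) subset_refl \<sigma>(2)] .
    then show ?thesis using u v p by (simp add: dirichlet_solution_def)
  qed
  have "2 * s \<le> 2 * n - 1" if "s < n" for s using that by simp
  note X = Dx_funpow_lincomb[OF perfect_sections_rect C(1,2) this]
    and Y = Dy_funpow_lincomb[OF perfect_sections_rect C(1,2) this]
  show ?thesis
    using u v L C_k_on_lincomb[OF perfect_sections_rect C(1,2)]
      C_k_on_lincomb[OF perfect_sections_open[OF open_Omega_plus_Un_minus] C(3,4)]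
    unfolding dirichlet_solution_def closure_Omega by (simp add: X Y)
qed

subsection \<open>Sine coefficients of homogeneous solutions\<close>

text \<open>The factor acting first maps \<open>u\<close> to a function \<open>h\<close> that
  satisfies the same hypotheses for the remaining factors. Its sine coefficient, a mode sum by
  induction, is the forcing in the oscillator equation for \<open>sine_coeff k u\<close>, and the
  new frequency differs from those already present.\<close>

lemma sine_coeff_eq_mode_sum:
  fixes a :: "nat \<Rightarrow> real" and c d :: real and k :: nat
  defines "W \<equiv> {0<..<1} \<times> {c<..<d}" and "\<mu> \<equiv> (\<lambda>j. pi * real k * a j)"
  assumes "js \<noteq> []" "distinct js" "\<And>j. j \<in> set js \<Longrightarrow> a j > 0" "inj_on a (set js)" "k \<ge> 1"
    and cd: "-1 \<le> c" "d \<le> 1" and \<sigma>: "\<sigma> = 1 \<or> \<sigma> = -1"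
    and "C_k_on (2 * length js - 1) rect u" "C_k_on (2 * length js) W u"
    and "\<And>s x y. s < length js \<Longrightarrow> y \<in> {-1..1} \<Longrightarrow> x \<in> {0, 1} \<Longrightarrow> (Dx rect ^^ (2 * s)) u (x, y) = 0"
    and "\<And>p. p \<in> W \<Longrightarrow> foldr (\<lambda>j. wave_factor rect \<sigma> (a j)) js u p = 0"
  shows "\<exists>p q. \<forall>y\<in>{c<..<d}. sine_coeff k u y = mode_sum (set js) \<mu> \<sigma> p q 0 y"
proof -
  have W: "open W" "W \<subseteq> rect" "W \<subseteq> W" unfolding W_def using cd by (auto intro: open_Times)
  have \<sigma>2: "\<sigma>\<^sup>2 = 1" using \<sigma> by auto
  have step: "\<exists>p q. \<forall>y\<in>{c<..<d}. sine_coeff k u y = mode_sum (insert j I) \<mu> \<sigma> p q 0 y"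
    if I: "finite I" "j \<notin> I" "inj_on a (insert j I)" "\<And>i. i \<in> insert j I \<Longrightarrow> a i > 0"
      and u: "C_k_on 1 rect u" "C_k_on 2 W u"
        "\<And>y x. y \<in> {-1..1} \<Longrightarrow> x \<in> {0, 1} \<Longrightarrow> u (x, y) = 0"
      and h: "continuous_on rect h" "\<And>p. p \<in> W \<Longrightarrow> wave_factor rect \<sigma> (a j) u p = h p"
      and H: "\<And>y. y \<in> {c<..<d} \<Longrightarrow> sine_coeff k h y = mode_sum I \<mu> \<sigma> p q 0 y"
    for j I u h p q
  proof (rule forced_oscillator_solution[OF \<sigma> I(1,2)])
    have pos: "\<mu> i > 0" if "i \<in> insert j I" for i
      unfolding \<mu>_def using I(4)[OF that] \<open>k \<ge> 1\<close> by simp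
    show "\<mu> j \<noteq> 0" using pos[of j] by simp
    show "(\<mu> i)\<^sup>2 \<noteq> (\<mu> j)\<^sup>2" if "i \<in> I" for i
    proof
      assume "(\<mu> i)\<^sup>2 = (\<mu> j)\<^sup>2"
      then have "\<mu> i = \<mu> j" using pos[of i] pos[of j] that by (simp add: power2_eq_iff)
      then have "a i = a j" using \<open>k \<ge> 1\<close> by (simp add: \<mu>_def)
      then show False using I(2,3) that by (metis inj_onD insertCI)
    qed
    fix y assume y: "y \<in> {c<..<d}"
    have u1: "C_k_on (Suc 0) rect u" using u(1) by simp
    show "(sine_coeff k u has_real_derivative sine_coeff k (Dy rect u) y) (at y)"
      using sine_coeff_has_derivative[OF u1, of y k] y cd at_within_interior[of y "{-1..1}"]
      by (simp add: interior_atLeastAtMost_real)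
    show "(sine_coeff k (Dy rect u) has_real_derivative \<sigma> * ((\<mu> j)\<^sup>2 * sine_coeff k u y + sine_coeff k h y)) (at y)"
      unfolding \<mu>_def
      by (rule sine_coeff_wave_factor[OF u(1) u(2)[unfolded W_def] cd _ h(1) h(2)[unfolded W_def] \<sigma>2 y])
        (use u(3) cd in auto)
    show "sine_coeff k h y = mode_sum I \<mu> \<sigma> p q 0 y" by (rule H[OF y])
  qed
  show ?thesis
    using assms(3-6,11-14)
  proof (induction js arbitrary: u rule: rev_nonempty_induct)
    \<comment> \<open>With one factor the forcing is 0, the mode sum over the empty set.\<close>
    case (single j)
    have "sine_coeff k (\<lambda>_. 0) y = mode_sum {} \<mu> \<sigma> (\<lambda>_. 0) (\<lambda>_. 0) 0 y" for y
      by (simp add: sine_coeff_def mode_sum_def)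
    from step[OF _ _ _ _ _ _ _ _ _ this, of j u] single show ?case by simp
  next
    \<comment> \<open>\<open>foldr\<close> applies the last list element first, so \<open>j\<close>
      is the innermost factor and the list is shortened from the right.\<close>
    case (snoc j js)
    define h where "h = wave_factor rect \<sigma> (a j) u"
    obtain m where m: "length js = Suc m" using snoc.hyps by (cases js) auto
    have u: "C_k_on (Suc (Suc (2 * length js - 1))) rect u" "C_k_on (Suc (Suc (2 * length js))) W u"
      using snoc.prems(4,5) m by (simp_all del: C_k_on.simps)
    have h1: "C_k_on (2 * length js - 1) rect h"
      unfolding h_def by (rule C_k_on_wave_factor[OF perfect_sections_rect u(1)])
    \<comment> \<open>The interior regularity of \<open>h\<close> is read off from its version
      relative to \<open>W\<close>, with which it agrees there.\<close>
    have "C_k_on (2 * length js) W (wave_factor W \<sigma> (a j) u)"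
      by (rule C_k_on_wave_factor[OF perfect_sections_open[OF W(1)] u(2)])
    moreover have "wave_factor W \<sigma> (a j) u p = h p" if "p \<in> W" for p
      unfolding h_def by (rule wave_factor_local[OF W(1) W(3) W(2) refl that])
    ultimately have h2: "C_k_on (2 * length js) W h" using C_k_on_cong by blast
    have "\<exists>p q. \<forall>y\<in>{c<..<d}. sine_coeff k h y = mode_sum (set js) \<mu> \<sigma> p q 0 y"
    proof (rule snoc.IH[OF _ _ _ h1 h2])
      show "distinct js" "\<And>i. i \<in> set js \<Longrightarrow> 0 < a i" "inj_on a (set js)"
        using snoc.prems(1-3) by (auto intro: inj_on_subset)
      show "foldr (\<lambda>j. wave_factor rect \<sigma> (a j)) js h p = 0" if "p \<in> W" for p
        using snoc.prems(7)[OF that] by (simp add: h_def)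
      fix s :: nat and x y :: real assume *: "s < length js" "y \<in> {-1..1}" "x \<in> {0, 1}"
      have "C_k_on (2 * length js) rect u" using m by (intro C_k_on_mono[OF u(1)]) simp
      then show "(Dx rect ^^ (2 * s)) h (x, y) = 0"
        unfolding h_def
        by (rule Dx_funpow_wave_factor_eq_0[where m = "length js", rotated 2])
          (use * snoc.prems(6) in auto)
    qed
    then obtain p q where pq: "\<And>y. y \<in> {c<..<d} \<Longrightarrow> sine_coeff k h y = mode_sum (set js) \<mu> \<sigma> p q 0 y"
      by blast
    have "\<exists>p q. \<forall>y\<in>{c<..<d}. sine_coeff k u y = mode_sum (insert j (set js)) \<mu> \<sigma> p q 0 y"
    proof (rule step[OF _ _ _ _ _ _ _ _ _ pq])
      show "C_k_on 1 rect u" "C_k_on 2 W u"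
        using C_k_on_mono[OF u(1), of 1] C_k_on_mono[OF u(2), of 2] by auto
      show "continuous_on rect h" using h1 by (rule C_k_on_imp_continuous_on)
      show "u (x, y) = 0" if "y \<in> {-1..1}" "x \<in> {0, 1}" for x y
        using snoc.prems(6)[of 0 y x] that by simp
    qed (use snoc.prems(1-3) h_def in auto)
    then show ?case by simp
  qed
qed

text \<open>Equality inside the interval extends to the endpoints by continuity at order 0, and then
  order by order by uniqueness of derivatives relative to the closed interval. It yields the values
  at y = 0, 1 and -1, where the mode formula is not derived directly.\<close>

lemma derivative_sequences_eq:
  fixes G M :: "nat \<Rightarrow> real \<Rightarrow> real"
  assumes "c < d" and G: "\<And>t y. t < N \<Longrightarrow> y \<in> {c..d} \<Longrightarrow> (G t has_real_derivative G (Suc t) y) (at y within {c..d})"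
    and M: "\<And>t y. y \<in> {c..d} \<Longrightarrow> (M t has_real_derivative M (Suc t) y) (at y within {c..d})"
    and eq: "continuous_on {c..d} (G 0)" "\<And>y. y \<in> {c<..<d} \<Longrightarrow> G 0 y = M 0 y"
    and "t \<le> N" "y \<in> {c..d}"
  shows "G t y = M t y"
  using assms(6,7)
proof (induction t arbitrary: y)
  case 0
  have "continuous_on {c..d} (M 0)" by (rule DERIV_continuous_on) (rule M)
  then have "continuous_on (closure {c<..<d}) (\<lambda>y. G 0 y - M 0 y)"
    using eq(1) assms(1) by (auto intro!: continuous_intros)
  then have "G 0 y - M 0 y = 0"
    by (rule continuous_constant_on_closure) (use eq(2) 0 assms(1) in auto)
  then show ?case by simp
next
  case (Suc t)
  have "(M t has_real_derivative G (Suc t) y) (at y within {c..d})"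
    by (rule has_field_derivative_transform_within[OF G, of t y 1]) (use Suc in auto)
  moreover have "at y within {c..d} \<noteq> bot"
    using Suc.prems(2) assms(1) by (simp only: trivial_limit_within islimpt_Icc not_not)
  ultimately show ?case
    using M[OF Suc.prems(2), of t] vector_derivative_unique_within
    by (metis has_real_derivative_iff_has_vector_derivative)
qed

lemma sine_coeff_homogeneous_eq_0:
  fixes a :: "nat \<Rightarrow> real"
  assumes n: "n \<ge> 1" and a: "\<And>j. j \<in> {1..n} \<Longrightarrow> a j > 0" "inj_on a {1..n}"
    and k: "k \<ge> 1" "Delta n a k \<noteq> 0"
    and w: "dirichlet_solution n a (\<lambda>_ _. 0) (\<lambda>_ _. 0) w" and y: "y \<in> {-1..1}"
  shows "sine_coeff k w y = 0"
proof -
  define \<mu> where "\<mu> = (\<lambda>j. pi * real k * a j)"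
  define G where "G = (\<lambda>t. sine_coeff k ((Dy rect ^^ t) w))"
  have C: "C_k_on (2 * n - 1) rect w" "C_k_on (2 * n) (Omega_plus \<union> Omega_minus) w"
    using w by (auto simp: dirichlet_solution_def closure_Omega)
  have G': "(G t has_real_derivative G (Suc t) y) (at y within {-1..1})"
    if "t < 2 * n - 1" "y \<in> {-1..1}" for t y
  proof -
    obtain i where "2 * n - 1 = t + Suc i" using \<open>t < 2 * n - 1\<close> less_imp_Suc_add by force
    then have "C_k_on (Suc i) rect ((Dy rect ^^ t) w)" using C_k_on_Dy[of t "Suc i" rect w] C(1) by simp
    from sine_coeff_has_derivative[OF this that(2)] show ?thesis by (simp add: G_def)
  qed
  have G0: "continuous_on {-1..1} (G 0)"
    unfolding G_def using C(1) by (auto intro!: continuous_on_sine_coeff dest: C_k_on_imp_continuous_on)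
  have modes: "\<exists>p q. \<forall>y\<in>{c<..<d}. G 0 y = mode_sum {1..n} \<mu> \<sigma> p q 0 y"
    if \<sigma>: "\<sigma> = 1 \<or> \<sigma> = -1" and h: "half \<sigma> = {0<..<1} \<times> {c<..<d}" and cd: "-1 \<le> c" "d \<le> 1" for \<sigma> c d
  proof -
    have set: "set [1..<Suc n] = {1..n}" by (simp only: set_upt atLeastLessThanSuc_atLeastAtMost)
    have "\<exists>p q. \<forall>y\<in>{c<..<d}. sine_coeff k w y = mode_sum (set [1..<Suc n]) \<mu> \<sigma> p q 0 y"
      unfolding \<mu>_def
    proof (rule sine_coeff_eq_mode_sum[OF _ _ _ _ k(1) cd \<sigma>])
      show "C_k_on (2 * length [1..<Suc n]) ({0<..<1} \<times> {c<..<d}) w"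
        using C_k_on_open_subset[OF half(1,2)[OF \<sigma>] C(2)] by (simp only: h length_upt diff_Suc_1)
      show "foldr (\<lambda>j. wave_factor rect \<sigma> (a j)) [1..<Suc n] w p = 0"
        if "p \<in> {0<..<1} \<times> {c<..<d}" for p
      proof -
        have p: "p \<in> half \<sigma>" using that h by simp
        then have "L_op n a w p = 0" using w half(2)[OF \<sigma>] by (auto simp: dirichlet_solution_def)
        then show ?thesis using L_op_eq_wave_factor[OF \<sigma> half(3)[OF \<sigma>] p, of n a w] by simp
      qed
      show "(Dx rect ^^ (2 * s)) w (x, y) = 0"
        if "s < length [1..<Suc n]" "y \<in> {-1..1}" "x \<in> {0, 1}" for s x y
        using that w by (auto simp: dirichlet_solution_def closure_Omega simp del: upt_Suc)
      show "C_k_on (2 * length [1..<Suc n] - 1) rect w" using C(1) by (simp only: length_upt diff_Suc_1)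
    qed (use a n set in \<open>simp_all del: upt_Suc\<close>)
    then show ?thesis unfolding set G_def by simp
  qed
  obtain p q where pq: "\<And>y. y \<in> {0<..<1} \<Longrightarrow> G 0 y = mode_sum {1..n} \<mu> 1 p q 0 y"
    using modes[of 1 0 1] by (auto simp: half_def)
  obtain p' q' where pq': "\<And>y. y \<in> {-1<..<0} \<Longrightarrow> G 0 y = mode_sum {1..n} \<mu> (-1) p' q' 0 y"
    using modes[of "-1" "-1" 0] by (auto simp: half_def)
  \<comment> \<open>The order \<open>2 * n - 1\<close> is the last for which the y-derivative of
    \<open>w\<close> is known to be continuous at y = 0. Both this formula and its counterpart below
    include y = 0, and their comparison there gives the matching conditions.\<close>
  have right: "G t y = mode_sum {1..n} \<mu> 1 p q t y" if "t \<le> 2 * n - 1" "y \<in> {0..1}" for t y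
  proof (rule derivative_sequences_eq[where c = 0 and d = 1 and N = "2 * n - 1" and G = G and M = "mode_sum {1..n} \<mu> 1 p q"])
    show "(G t has_real_derivative G (Suc t) y) (at y within {0..1})" if "t < 2 * n - 1" "y \<in> {0..1}" for t y
      by (rule has_field_derivative_subset[OF G']) (use that in auto)
  qed (use that pq in \<open>auto intro: mode_sum_has_derivative continuous_on_subset[OF G0]\<close>)
  have left: "G t y = mode_sum {1..n} \<mu> (-1) p' q' t y" if "t \<le> 2 * n - 1" "y \<in> {-1..0}" for t y
  proof (rule derivative_sequences_eq[where c = "-1" and d = 0 and N = "2 * n - 1" and G = G and M = "mode_sum {1..n} \<mu> (-1) p' q'"])
    show "(G t has_real_derivative G (Suc t) y) (at y within {-1..0})" if "t < 2 * n - 1" "y \<in> {-1..0}" for t y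
      by (rule has_field_derivative_subset[OF G']) (use that in auto)
  qed (use that pq' in \<open>auto intro: mode_sum_has_derivative continuous_on_subset[OF G0]\<close>)
  have "kernel_modes n \<mu> p q p' q'"
    unfolding kernel_modes_def
  proof (intro conjI allI impI)
    fix m assume m: "m < n"
    have "G (2 * m) y = 0" if "y = 1 \<or> y = -1" for y
    proof -
      have "G (2 * m) y = integral {0..1} (\<lambda>_::real. 0)"
        unfolding G_def sine_coeff_def
        by (rule integral_cong) (use w m that in \<open>auto simp: dirichlet_solution_def closure_Omega\<close>)
      then show ?thesis by simp
    qed
    then show "mode_sum {1..n} \<mu> 1 p q (2 * m) 1 = 0" "mode_sum {1..n} \<mu> (-1) p' q' (2 * m) (-1) = 0"
      using right[of "2 * m" 1] left[of "2 * m" "-1"] m by auto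
  next
    fix t assume "t < 2 * n"
    then show "mode_sum {1..n} \<mu> 1 p q t 0 = mode_sum {1..n} \<mu> (-1) p' q' t 0"
      using right[of t 0] left[of t 0] by simp
  qed
  then have "\<forall>s\<in>{1..n}. p s = 0 \<and> q s = 0 \<and> p' s = 0 \<and> q' s = 0"
    using Delta_eq_0_iff[OF k(1), of n a] k(2) unfolding \<mu>_def by blast
  then have "mode_sum {1..n} \<mu> \<sigma> p q 0 y = 0" "mode_sum {1..n} \<mu> \<sigma> p' q' 0 y = 0" for \<sigma> y
    by (auto simp: mode_sum_def mode_def intro!: sum.neutral)
  moreover have "y \<in> {0..1} \<or> y \<in> {-1..0}" using y by auto
  ultimately have "G 0 y = 0" using right[of 0 y] left[of 0 y] by auto
  then show ?thesis by (simp add: G_def)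
qed

lemma homogeneous_solution_eq_0:
  assumes n: "n \<ge> 1" and a: "\<And>j. j \<in> {1..n} \<Longrightarrow> a j > 0" "inj_on a {1..n}"
    and Delta: "\<And>k. k \<ge> 1 \<Longrightarrow> Delta n a k \<noteq> 0"
    and w: "dirichlet_solution n a (\<lambda>_ _. 0) (\<lambda>_ _. 0) w" and p: "p \<in> closure Omega"
  shows "w p = 0"
proof -
  obtain x y where xy: "p = (x, y)" "x \<in> {0..1}" "y \<in> {-1..1}" using p by (auto simp: closure_Omega)
  show ?thesis
  proof (cases "x \<in> {0<..<1}")
    case True
    have "continuous_on rect w"
      using w C_k_on_imp_continuous_on by (auto simp: dirichlet_solution_def closure_Omega)
    from continuous_on_rect_x[OF this xy(3)] have "w (x, y) = 0"
    proof (rule sine_system_complete[OF _ _ True])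
      show "integral {0..1} (\<lambda>x. w (x, y) * sin (pi * real k * x)) = 0" if "k \<ge> 1" for k
        using sine_coeff_homogeneous_eq_0[OF n a that Delta[OF that] w xy(3)] by (simp add: sine_coeff_def)
    qed
    then show ?thesis by (simp add: xy)
  next
    case False
    then have "x = 0 \<or> x = 1" using xy(2) by auto
    \<comment> \<open>Completeness reaches only interior points; on the vertical edges the lateral
      condition of order 0 applies, present because \<open>n \<ge> 1\<close>.\<close>
    moreover have "w (0, y) = 0 \<and> w (1, y) = 0"
    proof -
      have "\<forall>s<n. \<forall>y\<in>{-1..1}. (Dx rect ^^ (2 * s)) w (0, y) = 0 \<and> (Dx rect ^^ (2 * s)) w (1, y) = 0"
        using w by (simp add: dirichlet_solution_def closure_Omega)
      from this[rule_format, of 0 y] show ?thesis using n xy(3) by simp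
    qed
    ultimately show ?thesis by (auto simp: xy)
  qed
qed

subsection \<open>Separated solutions\<close>

text \<open>\<open>F i\<close> and \<open>G j\<close> stand for the derivatives of orders
  \<open>i\<close> and \<open>j\<close> of the two factors. For \<open>F\<close> all orders are
  available; for \<open>G\<close> only those up to \<open>N\<close>, because a glued mode sum may
  lose its derivative of order \<open>2 * n\<close> at y = 0.\<close>

context
  fixes X Y :: "real set" and F G :: "nat \<Rightarrow> real \<Rightarrow> real" and N :: nat
  assumes XY: "perfect_sections (X \<times> Y)"
    and F: "\<And>i x. x \<in> X \<Longrightarrow> (F i has_real_derivative F (Suc i) x) (at x within X)"
    and G: "\<And>j y. j < N \<Longrightarrow> y \<in> Y \<Longrightarrow> (G j has_real_derivative G (Suc j) y) (at y within Y)"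
begin

lemma Dx_separable:
  assumes "p \<in> X \<times> Y"
  shows "Dx (X \<times> Y) (\<lambda>p. F i (fst p) * G j (snd p)) p = F (Suc i) (fst p) * G j (snd p)"
proof -
  obtain x y where p: "p = (x, y)" "x \<in> X" "y \<in> Y" using assms by auto
  show ?thesis
    unfolding p(1) by (rule Dx_eqI[OF XY]) (use p in \<open>auto simp: section_Times intro!: DERIV_cmult_right F\<close>)
qed

lemma Dy_separable:
  assumes "p \<in> X \<times> Y" "j < N"
  shows "Dy (X \<times> Y) (\<lambda>p. F i (fst p) * G j (snd p)) p = F i (fst p) * G (Suc j) (snd p)"
proof -
  obtain x y where p: "p = (x, y)" "x \<in> X" "y \<in> Y" using assms by auto
  show ?thesis
    unfolding p(1) by (rule Dy_eqI[OF XY]) (use p assms(2) in \<open>auto simp: section_Times intro!: DERIV_cmult G\<close>)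
qed

lemma Dx_funpow_separable:
  assumes "p \<in> X \<times> Y"
  shows "(Dx (X \<times> Y) ^^ i) (\<lambda>p. F 0 (fst p) * G j (snd p)) p = F i (fst p) * G j (snd p)"
  using assms
proof (induction i arbitrary: p)
  case (Suc i)
  show ?case using Dx_cong[OF Suc.IH Suc.prems] Dx_separable[OF Suc.prems] by simp
qed simp

lemma Dy_funpow_separable:
  assumes "p \<in> X \<times> Y" "j \<le> N"
  shows "(Dy (X \<times> Y) ^^ j) (\<lambda>p. F i (fst p) * G 0 (snd p)) p = F i (fst p) * G j (snd p)"
  using assms
proof (induction j arbitrary: p)
  case (Suc j)
  have "\<And>p. p \<in> X \<times> Y \<Longrightarrow> (Dy (X \<times> Y) ^^ j) (\<lambda>p. F i (fst p) * G 0 (snd p)) p = F i (fst p) * G j (snd p)"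
    using Suc.IH Suc.prems(2) by simp
  from Dy_cong[OF this Suc.prems(1)] show ?case
    using Dy_separable[OF Suc.prems(1), of j] Suc.prems(2) by simp
qed simp

lemma C_k_on_separable:
  assumes cont: "\<And>j. j \<le> N \<Longrightarrow> continuous_on Y (G j)" and "j + k \<le> N"
  shows "C_k_on k (X \<times> Y) (\<lambda>p. F i (fst p) * G j (snd p))"
proof -
  have sep: "continuous_on (X \<times> Y) (\<lambda>p. F i (fst p) * G j (snd p))" if "j \<le> N" for i j
  proof (rule continuous_on_mult)
    show "continuous_on (X \<times> Y) (\<lambda>p. F i (fst p))"
      by (rule continuous_on_compose2[OF DERIV_continuous_on[OF F]]) (auto intro: continuous_on_fst)
    show "continuous_on (X \<times> Y) (\<lambda>p. G j (snd p))"
      by (rule continuous_on_compose2[OF cont[OF that]]) (auto intro: continuous_on_snd)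
  qed
  show ?thesis
    using assms(2)
  proof (induction k arbitrary: i j)
    case (0 i j)
    then show ?case using sep[of j i] by simp
  next
    case (Suc k i j)
    show ?case
    proof (rule C_Suc_onI[OF XY])
      show "continuous_on (X \<times> Y) (\<lambda>p. F i (fst p) * G j (snd p))"
        using Suc.prems by (intro sep) simp
    show "C_k_on k (X \<times> Y) (\<lambda>p. F (Suc i) (fst p) * G j (snd p))"
      "C_k_on k (X \<times> Y) (\<lambda>p. F i (fst p) * G (Suc j) (snd p))"
      using Suc.prems by (auto intro!: Suc.IH)
  qed (use Suc.prems in \<open>auto simp: section_Times intro!: DERIV_cmult_right DERIV_cmult F G\<close>)
  qed
qed

end

section \<open>Gluing modes across y = 0\<close>

text \<open>At y = 0 the upper formula is used; the matching conditions make the choice immaterial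
  for orders below \<open>2 * n\<close>.\<close>

definition glued_modes :: "nat \<Rightarrow> (nat \<Rightarrow> real) \<Rightarrow> (nat \<Rightarrow> real) \<Rightarrow> (nat \<Rightarrow> real) \<Rightarrow>
    (nat \<Rightarrow> real) \<Rightarrow> (nat \<Rightarrow> real) \<Rightarrow> nat \<Rightarrow> real \<Rightarrow> real" where
  "glued_modes n \<mu> p q p' q' t y =
    (if 0 \<le> y then mode_sum {1..n} \<mu> 1 p q t y else mode_sum {1..n} \<mu> (-1) p' q' t y)"

lemma has_field_derivative_Un:
  "(f has_field_derivative D) (at x within S) \<Longrightarrow> (f has_field_derivative D) (at x within T) \<Longrightarrow>
    (f has_field_derivative D) (at x within (S \<union> T))"
  by (simp add: has_field_derivative_iff Lim_Un)

lemma glued_modes_left: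
  assumes "kernel_modes n \<mu> p q p' q'" "t < 2 * n" "y \<le> 0"
  shows "glued_modes n \<mu> p q p' q' t y = mode_sum {1..n} \<mu> (-1) p' q' t y"
  using assms by (cases "y = 0") (auto simp: glued_modes_def kernel_modes_def)

text \<open>At 0 the one-sided derivatives are the two mode sums of order \<open>Suc t\<close>,
  which a matching condition equates; this needs \<open>Suc t < 2 * n\<close>.\<close>

lemma glued_modes_has_derivative:
  assumes K: "kernel_modes n \<mu> p q p' q'" and t: "Suc t < 2 * n" and y: "y \<in> {-1..1}"
  shows "(glued_modes n \<mu> p q p' q' t has_real_derivative glued_modes n \<mu> p q p' q' (Suc t) y)
    (at y within {-1..1})"
proof -
  let ?G = "glued_modes n \<mu> p q p' q'"
  \<comment> \<open>A point outside a closed interval is not a limit point of it, so every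
    derivative relative to it holds vacuously. This lets the two intervals be combined at every
    \<open>y\<close>.\<close>
  have triv: "(?G t has_real_derivative D) (at y within S)" if "at y within S = bot" for S D
    using that by (simp add: has_field_derivative_iff)
  have "(?G t has_real_derivative ?G (Suc t) y) (at y within {0..1})"
  proof (cases "y \<in> {0..1}")
    case True
    then have "?G (Suc t) y = mode_sum {1..n} \<mu> 1 p q (Suc t) y" by (simp add: glued_modes_def)
    then show ?thesis
      by (simp only:) (rule has_field_derivative_transform_within[OF mode_sum_has_derivative, where d = 1],
          use True in \<open>simp_all add: glued_modes_def\<close>)
  next
    case False
    have "(0::real) < 1" by simp
    then show ?thesis using False
      by (intro triv) (simp only: trivial_limit_within islimpt_Icc not_False_eq_True)
  qed
  moreover have "(?G t has_real_derivative ?G (Suc t) y) (at y within {-1..0})"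
  proof (cases "y \<in> {-1..0}")
    case True
    then have "?G (Suc t) y = mode_sum {1..n} \<mu> (-1) p' q' (Suc t) y"
      using glued_modes_left[OF K t, of y] by simp
    then show ?thesis
      by (simp only:) (rule has_field_derivative_transform_within[OF mode_sum_has_derivative, where d = 1],
          use True glued_modes_left[OF K, of t] t in simp_all)
  next
    case False
    have "(-1::real) < 0" by simp
    then show ?thesis using False
      by (intro triv) (simp only: trivial_limit_within islimpt_Icc not_False_eq_True)
  qed
  moreover have "{-1..0} \<union> {0..1} = {-1..1::real}" by auto
  ultimately show ?thesis using has_field_derivative_Un by metis
qed

lemma continuous_on_glued_modes:
  assumes K: "kernel_modes n \<mu> p q p' q'" and t: "t < 2 * n"
  shows "continuous_on {-1..1} (glued_modes n \<mu> p q p' q' t)"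
proof -
  have "continuous_on {0..1} (glued_modes n \<mu> p q p' q' t)"
    by (rule continuous_on_eq[OF continuous_on_mode_sum]) (simp add: glued_modes_def)
  moreover have "continuous_on {-1..0} (glued_modes n \<mu> p q p' q' t)"
    by (rule continuous_on_eq[OF continuous_on_mode_sum]) (simp add: glued_modes_left[OF K t])
  moreover have "{-1..0} \<union> {0..1} = {-1..1::real}" by auto
  ultimately show ?thesis using continuous_on_closed_Un[of "{-1..0::real}" "{0..1}"] by auto
qed

text \<open>Away from y = 0 no matching is involved and derivatives of every order exist; this
  supplies the order \<open>2 * n\<close> that the equation needs.\<close>

lemma glued_modes_has_derivative_off_0:
  assumes y: "y \<in> {-1<..<0} \<union> {0<..<1}"
  shows "(glued_modes n \<mu> p q p' q' t has_real_derivative glued_modes n \<mu> p q p' q' (Suc t) y)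
    (at y within {-1<..<0} \<union> {0<..<1})"
proof (rule has_field_derivative_at_within, cases "y > 0")
  case True
  then have "(glued_modes n \<mu> p q p' q' t has_real_derivative mode_sum {1..n} \<mu> 1 p q (Suc t) y) (at y)"
    by (intro has_field_derivative_transform_within_open[OF mode_sum_has_derivative, of "{0<..}"])
      (auto simp: glued_modes_def)
  then show "(glued_modes n \<mu> p q p' q' t has_real_derivative glued_modes n \<mu> p q p' q' (Suc t) y) (at y)"
    using True by (simp add: glued_modes_def[of _ _ _ _ _ _ "Suc t"])
next
  case False
  then have "y < 0" using y by auto
  then have "(glued_modes n \<mu> p q p' q' t has_real_derivative mode_sum {1..n} \<mu> (-1) p' q' (Suc t) y) (at y)"
    by (intro has_field_derivative_transform_within_open[OF mode_sum_has_derivative, of "{..<0}"])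
      (auto simp: glued_modes_def)
  then show "(glued_modes n \<mu> p q p' q' t has_real_derivative glued_modes n \<mu> p q p' q' (Suc t) y) (at y)"
    using \<open>y < 0\<close> by (simp add: glued_modes_def[of _ _ _ _ _ _ "Suc t"])
qed

text \<open>A factor acts diagonally on products of sin(pi k x), written here as
  \<open>mode (-1) (pi * real k) 0 1 0\<close>, with modes in y: on the one of frequency \<mu> s it
  is multiplication by (\<mu> s)^2 - (\<mu> j)^2. \<open>E js s\<close> is the product of these
  eigenvalues over the list.\<close>

lemma foldr_wave_factor_mode_sum:
  fixes k n :: nat and a :: "nat \<Rightarrow> real" and P Q :: "nat \<Rightarrow> real"
  defines "\<mu> \<equiv> (\<lambda>s. pi * real k * a s)"
    and "E \<equiv> (\<lambda>js s. \<Prod>j\<leftarrow>js. (pi * real k * a s)\<^sup>2 - (pi * real k * a j)\<^sup>2)"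
  assumes \<sigma>: "\<sigma> = 1 \<or> \<sigma> = -1" and p: "p \<in> half \<sigma>"
    and u: "\<And>p. p \<in> half \<sigma> \<Longrightarrow> u p = mode (-1) (pi * real k) 0 1 0 (fst p) * mode_sum {1..n} \<mu> \<sigma> P Q 0 (snd p)"
  shows "foldr (\<lambda>j. wave_factor (half \<sigma>) \<sigma> (a j)) js u p =
    mode (-1) (pi * real k) 0 1 0 (fst p) *
      mode_sum {1..n} \<mu> \<sigma> (\<lambda>s. E js s * P s) (\<lambda>s. E js s * Q s) 0 (snd p)"
  using p
proof (induction js arbitrary: p)
  case Nil
  then show ?case using u by (simp add: E_def)
next
  case (Cons j js)
  define F where "F = mode (-1) (pi * real k) 0 1"
  define M where "M = mode_sum {1..n} \<mu> \<sigma> (\<lambda>s. E js s * P s) (\<lambda>s. E js s * Q s)"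
  define Y where "Y = (if \<sigma> = 1 then {0<..<1} else {-1<..<0::real})"
  have half_eq: "half \<sigma> = {0<..<1} \<times> Y" by (simp add: half_def Y_def)
  have XY: "perfect_sections ({0<..<1} \<times> Y)"
    using perfect_sections_open[OF half(1)[OF \<sigma>]] by (simp add: half_eq)
  have F': "(F i has_real_derivative F (Suc i) x) (at x within {0<..<1})" for i x
    unfolding F_def by (rule mode_has_derivative)
  have M': "(M i has_real_derivative M (Suc i) y) (at y within Y)" for i y
    unfolding M_def by (rule mode_sum_has_derivative)
  have p: "p \<in> {0<..<1} \<times> Y" using Cons.prems half_eq by simp
  have "foldr (\<lambda>j. wave_factor (half \<sigma>) \<sigma> (a j)) (j # js) u p =
      wave_factor (half \<sigma>) \<sigma> (a j) (\<lambda>p. F 0 (fst p) * M 0 (snd p)) p"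
    using wave_factor_local[OF half(1)[OF \<sigma>] subset_refl subset_refl Cons.IH Cons.prems]
    by (simp add: F_def M_def)
  also have "\<dots> = (a j)\<^sup>2 * (F 2 (fst p) * M 0 (snd p)) + \<sigma> * (F 0 (fst p) * M 2 (snd p))"
    using Dx_funpow_separable[where F = F and G = M and N = 2 and i = 2 and j = 0, OF XY F' M' p] Dy_funpow_separable[where F = F and G = M and N = 2 and i = 0 and j = 2, OF XY F' M' p]
    by (simp add: wave_factor_def half_eq numeral_2_eq_2)
  also have "F 2 (fst p) = - (pi * real k)\<^sup>2 * F 0 (fst p)"
    unfolding F_def numeral_2_eq_2 by (subst mode_Suc_Suc) (simp_all add: power2_eq_square)
  also have "(a j)\<^sup>2 * (- (pi * real k)\<^sup>2 * F 0 (fst p) * M 0 (snd p)) + \<sigma> * (F 0 (fst p) * M 2 (snd p)) =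
      F 0 (fst p) * (\<sigma> * M 2 (snd p) - (\<mu> j)\<^sup>2 * M 0 (snd p))"
    by (simp add: \<mu>_def algebra_simps power_mult_distrib)
  also have "\<sigma> * M 2 (snd p) - (\<mu> j)\<^sup>2 * M 0 (snd p) =
      mode_sum {1..n} \<mu> \<sigma> (\<lambda>s. E (j # js) s * P s) (\<lambda>s. E (j # js) s * Q s) 0 (snd p)"
  proof -
    have \<sigma>\<sigma>: "\<sigma> * (\<sigma> * x) = x" for x using \<sigma> by auto
    have E: "E (j # js) s = ((\<mu> s)\<^sup>2 - (\<mu> j)\<^sup>2) * E js s" for s
      by (simp add: E_def \<mu>_def)
    show ?thesis
      unfolding M_def mode_sum_def sum_distrib_left sum_subtractf[symmetric] numeral_2_eq_2
        mode_Suc_Suc[OF \<sigma>]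
      by (intro sum.cong refl, simp only: E mult.assoc mode_scale) (simp only: \<sigma>\<sigma> left_diff_distrib numeral_2_eq_2)
  qed
  finally show ?case by (simp add: F_def)
qed

lemma mode_solution:
  fixes a :: "nat \<Rightarrow> real"
  defines "\<mu> k \<equiv> (\<lambda>s. pi * real k * a s)"
  assumes n: "n \<ge> 1" and K: "kernel_modes n (\<mu> k) p q p' q'"
  shows "dirichlet_solution n a (\<lambda>_ _. 0) (\<lambda>_ _. 0)
    (\<lambda>z. mode (-1) (pi * real k) 0 1 0 (fst z) * glued_modes n (\<mu> k) p q p' q' 0 (snd z))"
proof -
  define F where "F = mode (-1) (pi * real k) 0 1"
  define G where "G = glued_modes n (\<mu> k) p q p' q'"
  define w where "w = (\<lambda>z. F 0 (fst z) * G 0 (snd z))"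
  let ?Y = "{-1<..<0} \<union> {0<..<1::real}"
  have F': "(F i has_real_derivative F (Suc i) x) (at x within X)" for i x X
    unfolding F_def by (rule mode_has_derivative)
  have G': "(G j has_real_derivative G (Suc j) y) (at y within {-1..1})"
    if "j < 2 * n - 1" "y \<in> {-1..1}" for j y
    unfolding G_def by (rule glued_modes_has_derivative[OF K]) (use that in auto)
  have G'': "(G j has_real_derivative G (Suc j) y) (at y within ?Y)" if "y \<in> ?Y" for j y
    unfolding G_def by (rule glued_modes_has_derivative_off_0[OF that])
  have S: "perfect_sections ({0<..<1} \<times> ?Y)"
    using perfect_sections_open[OF open_Omega_plus_Un_minus] by (simp only: Omega_plus_Un_minus)
  have contG: "continuous_on {-1..1} (G j)" if "j \<le> 2 * n - 1" for j
    unfolding G_def by (rule continuous_on_glued_modes[OF K]) (use that n in auto)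
  have "C_k_on (2 * n - 1) rect w"
    unfolding w_def by (rule C_k_on_separable[where F = F and G = G and N = "2 * n - 1", OF perfect_sections_rect F' G' contG]) auto
  moreover have "C_k_on (2 * n) (Omega_plus \<union> Omega_minus) w"
    unfolding w_def Omega_plus_Un_minus
    by (rule C_k_on_separable[where F = F and G = G and N = "2 * n", OF S F' G'' DERIV_continuous_on[OF G'']]) auto
  moreover have "L_op n a w z = 0" if z: "z \<in> Omega_plus \<union> Omega_minus" for z
  proof -
    obtain \<sigma> where \<sigma>: "\<sigma> = 1 \<or> \<sigma> = -1" "z \<in> half \<sigma>" using half_cases[OF z] .
    define P where "P = (if \<sigma> = 1 then p else p')"
    define Q where "Q = (if \<sigma> = 1 then q else q')"
    have w: "w z = mode (-1) (pi * real k) 0 1 0 (fst z) * mode_sum {1..n} (\<mu> k) \<sigma> P Q 0 (snd z)"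
      if "z \<in> half \<sigma>" for z
      using that \<sigma>(1) by (auto simp: w_def F_def G_def glued_modes_def half_def P_def Q_def split: if_splits)
    \<comment> \<open>The list contains \<open>j = s\<close> for each \<open>s\<close>, so the full
      operator annihilates every mode.\<close>
    have "(\<Prod>j\<leftarrow>[1..<Suc n]. (pi * real k * a s)\<^sup>2 - (pi * real k * a j)\<^sup>2) = 0" if "s \<in> {1..n}" for s
      using that by (simp add: prod_list_zero_iff del: upt_Suc)
    then have "mode_sum {1..n} (\<mu> k) \<sigma>
        (\<lambda>s. (\<Prod>j\<leftarrow>[1..<Suc n]. (pi * real k * a s)\<^sup>2 - (pi * real k * a j)\<^sup>2) * P s)
        (\<lambda>s. (\<Prod>j\<leftarrow>[1..<Suc n]. (pi * real k * a s)\<^sup>2 - (pi * real k * a j)\<^sup>2) * Q s) 0 y = 0" for y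
      unfolding mode_sum_def mode_scale by (intro sum.neutral) simp
    then show ?thesis
      unfolding L_op_eq_wave_factor[OF \<sigma>(1) subset_refl \<sigma>(2)]
      using foldr_wave_factor_mode_sum[OF \<sigma>(1,2), of w k n a P Q "[1..<Suc n]"] w
      unfolding \<mu>_def by simp
  qed
  moreover have "(Dx rect ^^ (2 * s)) w (x, y) = 0" if "y \<in> {-1..1}" "x = 0 \<or> x = 1" for s x y
  proof -
    have "F 0 x = 0" using that(2) sin_npi2[of k] by (auto simp: F_def mode_def)
    moreover have "F (2 * s) x = (- (pi * real k)\<^sup>2) ^ s * F 0 x"
      using mode_even[of "-1" "pi * real k" 0 1 s 0 x] by (simp add: F_def)
    moreover have "(Dx rect ^^ (2 * s)) w (x, y) = F (2 * s) x * G 0 y"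
      unfolding w_def using Dx_funpow_separable[where F = F and G = G and N = "2 * n - 1" and p = "(x, y)" and i = "2 * s" and j = 0, OF perfect_sections_rect F' G'] that by auto
    ultimately show ?thesis by simp
  qed
  moreover have "(Dy rect ^^ (2 * s)) w (x, y) = 0" if "s < n" "x \<in> {0..1}" "y = 1 \<or> y = -1" for s x y
  proof -
    have "G (2 * s) y = 0" using that(1,3) K by (auto simp: G_def glued_modes_def kernel_modes_def)
    moreover have "(Dy rect ^^ (2 * s)) w (x, y) = F 0 x * G (2 * s) y"
      unfolding w_def using Dy_funpow_separable[where F = F and G = G and N = "2 * n - 1" and p = "(x, y)" and i = 0 and j = "2 * s", OF perfect_sections_rect F' G'] that by auto
    ultimately show ?thesis by simp
  qed
  ultimately show ?thesis
    unfolding dirichlet_solution_def closure_Omega by (simp add: w_def F_def G_def)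
qed

text \<open>As 0 is an endpoint of both halves, vanishing on a half makes all derivatives of its
  mode sum at 0 vanish, and linear independence of the modes applies to each half
  separately.\<close>

lemma glued_modes_eq_0_imp_eq_0:
  assumes \<mu>: "\<And>i. i \<in> {1..n} \<Longrightarrow> \<mu> i > 0" "inj_on \<mu> {1..n}"
    and zero: "\<And>y. y \<in> {-1..1} \<Longrightarrow> glued_modes n \<mu> p q p' q' 0 y = 0" and s: "s \<in> {1..n}"
  shows "p s = 0 \<and> q s = 0 \<and> p' s = 0 \<and> q' s = 0"
proof -
  have *: "mode_sum {1..n} \<mu> \<sigma> P Q t 0 = 0"
    if "c < d" "0 \<in> {c..d}" "\<And>y. y \<in> {c<..<d} \<Longrightarrow> mode_sum {1..n} \<mu> \<sigma> P Q 0 y = 0" for \<sigma> P Q t c d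
    by (rule derivative_sequences_eq[where c = c and d = d and N = t and M = "\<lambda>_ _. 0"
          and G = "mode_sum {1..n} \<mu> \<sigma> P Q"])
      (use that in \<open>auto intro: mode_sum_has_derivative continuous_on_mode_sum\<close>)
  have "mode_sum {1..n} \<mu> 1 p q t 0 = 0" for t
  proof (rule *[of 0 1])
    fix y :: real assume "y \<in> {0<..<1}"
    then show "mode_sum {1..n} \<mu> 1 p q 0 y = 0" using zero[of y] by (auto simp: glued_modes_def)
  qed auto
  moreover have "mode_sum {1..n} \<mu> (-1) p' q' t 0 = 0" for t
  proof (rule *[of "-1" 0])
    fix y :: real assume "y \<in> {-1<..<0}"
    then show "mode_sum {1..n} \<mu> (-1) p' q' 0 y = 0" using zero[of y] by (auto simp: glued_modes_def)
  qed auto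
  ultimately show ?thesis
    using mode_sum_eq_0_imp_eq_0[of 1 "{1..n}" \<mu> p q s] mode_sum_eq_0_imp_eq_0[of "-1" "{1..n}" \<mu> p' q' s] \<mu> s
    by auto
qed

theorem theorem1:
  fixes n :: nat and a :: "nat \<Rightarrow> real" and \<phi> \<psi> :: "nat \<Rightarrow> real \<Rightarrow> real"
  assumes "n \<ge> 1"
    and "0 < a 1"
    and "strict_mono_on {1..n} a"
    and "\<exists>u. dirichlet_solution n a \<phi> \<psi> u"
  shows "(\<forall>u v. dirichlet_solution n a \<phi> \<psi> u \<longrightarrow> dirichlet_solution n a \<phi> \<psi> v \<longrightarrow>
            (\<forall>p \<in> closure Omega. u p = v p))
         \<longleftrightarrow> (\<forall>k::nat. k \<ge> 1 \<longrightarrow> Delta n a k \<noteq> 0)"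
proof
  have pos: "a j > 0" if "j \<in> {1..n}" for j
    using strict_mono_onD[OF assms(3), of 1 j] assms(2) that by (cases "j = 1") auto
  have inj: "inj_on a {1..n}" using assms(3) by (rule strict_mono_on_imp_inj_on)
  {
    assume unique: "\<forall>u v. dirichlet_solution n a \<phi> \<psi> u \<longrightarrow> dirichlet_solution n a \<phi> \<psi> v \<longrightarrow>
        (\<forall>p \<in> closure Omega. u p = v p)"
    show "\<forall>k::nat. k \<ge> 1 \<longrightarrow> Delta n a k \<noteq> 0"
    proof (intro allI impI notI)
      fix k :: nat assume k: "k \<ge> 1" and "Delta n a k = 0"
      define \<mu> where "\<mu> = (\<lambda>s. pi * real k * a s)"
      obtain p q p' q' where K: "kernel_modes n \<mu> p q p' q'"
        and N: "\<exists>s\<in>{1..n}. p s \<noteq> 0 \<or> q s \<noteq> 0 \<or> p' s \<noteq> 0 \<or> q' s \<noteq> 0"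
        using \<open>Delta n a k = 0\<close> unfolding Delta_eq_0_iff[OF k] \<mu>_def by blast
      define w where "w = (\<lambda>z. mode (-1) (pi * real k) 0 1 0 (fst z) * glued_modes n \<mu> p q p' q' 0 (snd z))"
      have w: "dirichlet_solution n a (\<lambda>_ _. 0) (\<lambda>_ _. 0) w"
        unfolding w_def \<mu>_def by (rule mode_solution[OF assms(1) K[unfolded \<mu>_def]])
      obtain u where u: "dirichlet_solution n a \<phi> \<psi> u" using assms(4) by blast
      have uw: "dirichlet_solution n a \<phi> \<psi> (\<lambda>p. u p + w p)"
        using dirichlet_solution_lincomb[OF assms(1) u w, of 1 1] by simp
      have w0: "w z = 0" if "z \<in> closure Omega" for z
        using unique[rule_format, OF uw u that] by simp
      have glued: "glued_modes n \<mu> p q p' q' 0 y = 0" if "y \<in> {-1..1}" for y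
      proof -
        \<comment> \<open>At x = 1/(2k) the factor sin(pi k x) equals 1, which isolates the factor
          depending on y.\<close>
        have "(1 / (2 * real k), y) \<in> closure Omega" using that k by (auto simp: closure_Omega field_simps)
        from w0[OF this] show ?thesis using k by (simp add: w_def mode_def)
      qed
      have \<mu>: "\<mu> i > 0" if "i \<in> {1..n}" for i using pos[OF that] k by (simp add: \<mu>_def)
      have "inj_on \<mu> {1..n}"
      proof (rule inj_onI)
        fix i j assume ij: "i \<in> {1..n}" "j \<in> {1..n}" "\<mu> i = \<mu> j"
        then have "a i = a j" using k by (simp add: \<mu>_def)
        then show "i = j" using inj_onD[OF inj _ ij(1,2)] by simp
      qed
      from glued_modes_eq_0_imp_eq_0[OF \<mu> this glued] show False using N by auto
    qed
  }
  assume Delta: "\<forall>k::nat. k \<ge> 1 \<longrightarrow> Delta n a k \<noteq> 0"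
  show "\<forall>u v. dirichlet_solution n a \<phi> \<psi> u \<longrightarrow> dirichlet_solution n a \<phi> \<psi> v \<longrightarrow>
      (\<forall>p \<in> closure Omega. u p = v p)"
  proof (intro allI impI ballI)
    fix u v p assume uv: "dirichlet_solution n a \<phi> \<psi> u" "dirichlet_solution n a \<phi> \<psi> v"
      and p: "p \<in> closure Omega"
    have "dirichlet_solution n a (\<lambda>_ _. 0) (\<lambda>_ _. 0) (\<lambda>p. u p - v p)"
      using dirichlet_solution_lincomb[OF assms(1) uv, of 1 "-1"] by simp
    from homogeneous_solution_eq_0[OF assms(1) pos inj Delta[rule_format] this p] show "u p = v p"
      by simp
  qed
qed

end
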